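(* There exists a positive absolute constant $c_5$ and, for every positive integer $d$, a positive constant $c_6=c_6(d)$, such that for every positive integer $d$ and every $p=p(n)$ with $n^{-d/3}(\log n)^{8/3}\le p\le 1$, asymptotically almost surely $$c_5\, n^{d/2}p^{1/2}\ \le\ F([n]^d_p)\ \le\ c_6\, n^{d/2}p^{1/2}.$$
   Context: For positive integers $d,n$, $[n]^d$ denotes the set of all vectors $(a_1,\dots,a_d)$ of integers with $0\le a_i\le n-1$. A subset $S\subseteq[n]^d$ is a Sidon set if all sums of two (not necessarily distinct) vectors of $S$ are distinct, i.e. whenever $a+b=c+e$ with $a,b,c,e\in S$ one has $\{a,b\}=\{c,e\}$. $[n]^d_p$ denotes the random subset of $[n]^d$ obtained by choosing each element independently with probability $p=p(n)$, and $F([n]^d_p)$ is the maximum size of a Sidon set contained in $[n]^d_p$. The integer $d$ is fixed, and "asymptotically almost surely" (a.a.s.) means with probability tending to $1$ as $n\to\infty$; the bounds on $p(n)$ are assumed for all sufficiently large $n$. $\log$ is the natural logarithm. *)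

theory Defs
  imports "HOL-Probability.Probability" "HOL-Probability.Product_PMF"
begin

text \<open>
  The dimension is quantified inside the theorem, so integer vectors of length \<open>d\<close> are
  represented as functions \<open>nat \<Rightarrow> int\<close> whose coordinates are indexed by \<open>{..<d}\<close> and which
  vanish elsewhere; addition of vectors is then pointwise addition.
\<close>

definition grid :: "nat \<Rightarrow> nat \<Rightarrow> (nat \<Rightarrow> int) set" where
  "grid d n = PiE_dflt {..<d} 0 (\<lambda>_. {0..int n - 1})"

lemma finite_grid [simp]: "finite (grid d n)"
  unfolding grid_def by (intro finite_PiE_dflt) auto

lemma card_grid: "card (grid d n) = n ^ d"
  unfolding grid_def by (subst card_PiE_dflt) auto

definition sidon :: "(nat \<Rightarrow> int) set \<Rightarrow> bool" where
  "sidon S \<longleftrightarrow> (\<forall>a\<in>S. \<forall>b\<in>S. \<forall>c\<in>S. \<forall>e\<in>S.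
     (\<lambda>i. a i + b i) = (\<lambda>i. c i + e i) \<longrightarrow> {a, b} = {c, e})"

text \<open>Only meaningful for finite \<open>A\<close>; subsets of \<^term>\<open>grid d n\<close> are finite.\<close>

definition max_sidon :: "(nat \<Rightarrow> int) set \<Rightarrow> nat" where
  "max_sidon A = Max (card ` {S. S \<subseteq> A \<and> sidon S})"

text \<open>
  The random subset of the grid that contains each point independently with probability \<open>q\<close>.
  The intended range is \<open>0 \<le> q \<le> 1\<close>.
\<close>

definition random_grid :: "nat \<Rightarrow> nat \<Rightarrow> real \<Rightarrow> (nat \<Rightarrow> int) set pmf" where
  "random_grid d n q =
     map_pmf (\<lambda>f. {x \<in> grid d n. f x}) (Pi_pmf (grid d n) False (\<lambda>_. bernoulli_pmf q))"

end

theory Submission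
  imports Defs "HOL-Number_Theory.Prime_Powers" "HOL-Real_Asymp.Real_Asymp"
begin

text \<open>
  Write \<open>N = n\<^sup>d\<close>. Both bounds are first-moment arguments; what makes them work is a sharp count of
  Sidon sets for the upper bound and a Sidon set in a cyclic group for the lower bound.

  \<^emph>\<open>Upper bound.\<close> The expected number of Sidon sets with \<open>M\<close> elements inside the random set is
  \<open>Z(M) p\<^sup>M\<close>, where \<open>Z(M)\<close> counts the Sidon sets with \<open>M\<close> elements in the grid. For
  \<open>M = C \<surd>(Np)\<close> this tends to 0 as soon as \<open>Z(M)\<close> is about \<open>(C' N / M\<^sup>2)\<^sup>M\<close>, which is smaller by
  a factor of about \<open>M\<^sup>M\<close> than the number of all \<open>M\<close>-subsets. The count is obtained by doubling. A
  Sidon set \<open>A\<close> with \<open>s\<close> elements defines a conflict graph on the grid (\<open>x\<close> and \<open>y\<close> are adjacent if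
  \<open>x + a = y + b\<close> for some \<open>a\<close>, \<open>b\<close> in \<open>A\<close>), and any Sidon extension of \<open>A\<close> adds an independent set
  of this graph. By Cauchy-Schwarz every vertex set \<open>U\<close> of at least about \<open>N / s\<close> vertices contains
  a vertex adjacent to a proportion of about \<open>s\<^sup>2 / N\<close> of \<open>U\<close>
  (lemma \<open>exists_vertex_of_high_conflict_degree\<close>). Hence the argument of Kleitman and Winston
  (lemma \<open>card_independent_sets_le\<close>) confines an independent set, after about \<open>(N / s\<^sup>2) ln N\<close> freely
  chosen elements, to about \<open>N / s\<close> vertices, and the number of extensions by \<open>s\<close> elements is about
  \<open>(C N / s\<^sup>2)\<^sup>s\<close> (lemma \<open>card_sidon_sets_step\<close>). The freely chosen elements are negligible from
  \<open>s = (N ln N)\<^sup>1\<^sup>/\<^sup>3\<close> on, and the elements chosen before that scale cost a factor of about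
  \<open>exp (N\<^sup>1\<^sup>/\<^sup>3 (ln N)\<^sup>4\<^sup>/\<^sup>3)\<close>. This is \<open>exp (O(M))\<close> exactly when \<open>p\<close> is at least of order
  \<open>N\<^sup>-\<^sup>1\<^sup>/\<^sup>3 (ln N)\<^sup>8\<^sup>/\<^sup>3\<close>.

  \<^emph>\<open>Lower bound.\<close> Reading a vector as the digits of an integer in base \<open>n\<close> is additive and maps the
  grid onto \<open>{0..<N}\<close>; the problem becomes one about integers, and the constant does not depend on
  \<open>d\<close>. For a prime \<open>q\<close> the construction of Erdos and Turan gives \<open>q\<close> residues modulo \<open>L = 4 q\<^sup>2\<close>
  forming a Sidon set of the cyclic group. One point of the random set for each of these residues
  that it meets gives a Sidon set.
  If \<open>L\<close> is at most \<open>Np/8\<close>, then each residue class has about \<open>N / L\<close> points, and the probability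
  that some \<open>q / 2\<close> of the classes are all missed is exponentially small in \<open>q\<close>
  (lemma \<open>prob_max_sidon_less_half_le\<close>). Chebyshev's bounds supply a prime between consecutive large
  powers of 4, so that \<open>q\<close> can be taken of order \<open>\<surd>(Np)\<close> with an absolute constant.
\<close>

section \<open>Primes between consecutive powers of four\<close>

definition chebyshev_psi :: "nat \<Rightarrow> real" where
  "chebyshev_psi n = (\<Sum>d = 1..n. mangoldt d)"

text \<open>
  Summing \<open>ln m = (\<Sum>d | d dvd m. mangoldt d)\<close> over \<open>m \<le> n\<close> counts each \<open>d\<close> once for every multiple of
  it up to \<open>n\<close>.
\<close>
lemma ln_fact_eq_sum_mangoldt:
  "ln (fact n) = (\<Sum>d = 1..n. mangoldt d * real (n div d))"
proof (induction n)
  case (Suc n)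
  have "(\<Sum>d = 1..Suc n. mangoldt d * real (Suc n div d)) =
        (\<Sum>d = 1..Suc n. mangoldt d * real (n div d) + (if d dvd Suc n then mangoldt d else 0))"
    by (intro sum.cong) (auto simp: div_Suc dvd_eq_mod_eq_0 algebra_simps)
  also have "\<dots> = (\<Sum>d = 1..Suc n. mangoldt d * real (n div d)) +
      (\<Sum>d = 1..Suc n. if d dvd Suc n then mangoldt d else 0)"
    by (rule sum.distrib)
  also have "(\<Sum>d = 1..Suc n. mangoldt d * real (n div d)) = (\<Sum>d = 1..n. mangoldt d * real (n div d))"
    by simp
  also have "(\<Sum>d = 1..Suc n. if d dvd Suc n then mangoldt d else 0) =
     (\<Sum>d | d dvd Suc n. mangoldt d :: real)"
    by (intro sum.mono_neutral_cong_right) (auto intro!: Suc_leI Nat.gr0I dest: dvd_imp_le)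
  also have "\<dots> = ln (real (Suc n))"
    by (subst mangoldt_sum) auto
  finally have "(\<Sum>d = 1..Suc n. mangoldt d * real (Suc n div d)) = ln (fact n) + ln (real (Suc n))"
    by (simp only: Suc.IH)
  then show ?case
    by (simp only: fact_Suc of_nat_mult) (simp add: ln_mult del: of_nat_Suc)
qed auto

text \<open>
  In the expansion of \<open>ln (2m)! - 2 ln m!\<close> the coefficient \<open>\<lfloor>2m/d\<rfloor> - 2\<lfloor>m/d\<rfloor>\<close> of \<open>mangoldt d\<close> is always
  0 or 1, and it is 1 for \<open>m < d \<le> 2m\<close>.
\<close>
lemma ln_central_binomial_bounds:
  shows "chebyshev_psi (2 * m) - chebyshev_psi m \<le> ln (real ((2 * m) choose m))"
    and "ln (real ((2 * m) choose m)) \<le> chebyshev_psi (2 * m)"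
proof -
  define c where "c d = real (2 * m div d) - 2 * real (m div d)" for d
  have c: "0 \<le> c d" "c d \<le> 1" for d
  proof -
    have a: "2 * (m div d) \<le> 2 * m div d"
      by (cases "d = 0") (auto simp: less_eq_div_iff_mult_less_eq mult.assoc)
    have b: "2 * m div d \<le> 2 * (m div d) + 1"
    proof (cases "d = 0")
      case False
      then have "m < d * (m div d) + d"
        by (metis add_less_cancel_left bot_nat_0.not_eq_extremum mod_less_divisor mult_div_mod_eq)
      then have "2 * m < (2 * (m div d) + 2) * d"
        by (simp add: algebra_simps)
      then have "2 * m div d < 2 * (m div d) + 2"
        using False by (simp add: less_mult_imp_div_less)
      then show ?thesis by simp
    qed simp
    have "2 * real (m div d) \<le> real (2 * m div d)" using a
      by (metis of_nat_le_iff of_nat_mult of_nat_numeral)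
    moreover have "real (2 * m div d) \<le> 2 * real (m div d) + 1" using b
      by (metis (mono_tags) of_nat_1 of_nat_add of_nat_le_iff of_nat_mult of_nat_numeral)
    ultimately show "0 \<le> c d" "c d \<le> 1" by (auto simp: c_def)
  qed
  have c1: "c d = 1" if "d \<in> {m<..2*m}" for d
  proof -
    have "2 * m div d = 1" using that by (intro div_nat_eqI) auto
    then show ?thesis using that by (simp add: c_def)
  qed
  have "ln (real ((2 * m) choose m)) = ln (fact (2 * m) / (fact m * fact m))"
    by (subst binomial_fact) (auto simp: mult_2)
  also have "\<dots> = ln (fact (2 * m)) - 2 * ln (fact m)"
    by (simp add: ln_div ln_mult)
  also have "ln (fact m) = (\<Sum>d = 1..2*m. mangoldt d * real (m div d))"
    unfolding ln_fact_eq_sum_mangoldt by (intro sum.mono_neutral_left) auto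
  also have "ln (fact (2 * m)) - 2 * \<dots> = (\<Sum>d = 1..2*m. mangoldt d * c d)"
    unfolding ln_fact_eq_sum_mangoldt c_def sum_distrib_left sum_subtractf [symmetric]
    by (intro sum.cong) (auto simp: algebra_simps)
  finally have eq: "ln (real ((2 * m) choose m)) = (\<Sum>d = 1..2*m. mangoldt d * c d)" .
  show "ln (real ((2 * m) choose m)) \<le> chebyshev_psi (2 * m)"
    unfolding eq chebyshev_psi_def
    using c by (intro sum_mono mult_left_le) (auto intro: mangoldt_nonneg)
  have "chebyshev_psi (2 * m) - chebyshev_psi m = (\<Sum>d\<in>{1..2*m} - {1..m}. mangoldt d)"
    unfolding chebyshev_psi_def by (subst sum_diff) auto
  also have "\<dots> = (\<Sum>d\<in>{m<..2*m}. mangoldt d * c d)"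
    by (intro sum.cong) (auto simp: c1)
  also have "\<dots> \<le> (\<Sum>d = 1..2*m. mangoldt d * c d)"
    using c by (intro sum_mono2) (auto intro!: mult_nonneg_nonneg mangoldt_nonneg)
  finally show "chebyshev_psi (2 * m) - chebyshev_psi m \<le> ln (real ((2 * m) choose m))"
    by (simp add: eq)
qed

lemma chebyshev_psi_power2_le: "chebyshev_psi (2 ^ k) \<le> 2 ^ k * ln 4"
proof (induction k)
  case 0
  then show ?case by (simp add: chebyshev_psi_def)
next
  case (Suc k)
  have "ln (real ((2 * 2 ^ k) choose (2 ^ k))) \<le> ln (2 ^ (2 * 2 ^ k))"
    using binomial_le_pow2[of "2 * 2 ^ k" "2 ^ k"]
    by (subst ln_le_cancel_iff) (auto simp flip: of_nat_le_iff)
  also have "\<dots> = 2 ^ k * ln 4"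
    by (subst power_mult) (simp add: ln_realpow)
  finally show ?case
    using ln_central_binomial_bounds(1)[of "2 ^ k"] Suc by simp
qed

lemma chebyshev_psi_power2_ge: "2 ^ k * ln 4 - (real k + 1) * ln 2 \<le> chebyshev_psi (2 ^ Suc k)"
proof -
  have "2 ^ k * ln 4 - (real k + 1) * ln 2 = ln (4 ^ (2 ^ k) / 2 ^ Suc k)"
    by (simp add: ln_div ln_realpow ln_mult algebra_simps)
  also have "\<dots> \<le> ln (real ((2 * 2 ^ k) choose (2 ^ k)))"
    using central_binomial_lower_bound[of "2 ^ k"]
    by (subst ln_le_cancel_iff) auto
  also have "\<dots> \<le> chebyshev_psi (2 ^ Suc k)"
    using ln_central_binomial_bounds(2)[of "2 ^ k"] by simp
  finally show ?thesis .
qed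

text \<open>
  Proper prime powers are too few to matter for the difference of two values of \<open>\<psi>\<close>: a number
  \<open>p\<^sup>j \<le> 4\<^sup>h\<close> with \<open>j \<ge> 2\<close> has \<open>p \<le> 2\<^sup>h\<close> and \<open>j \<le> 2h\<close>.
\<close>
lemma card_proper_primepows_le:
  "card {d. primepow d \<and> \<not> prime d \<and> d \<le> (4::nat) ^ h} \<le> (2 ^ h + 1) * (2 * h + 1)"
proof -
  have "{d. primepow d \<and> \<not> prime d \<and> d \<le> (4::nat) ^ h} \<subseteq> (\<lambda>(p, j). p ^ j) ` ({..2 ^ h} \<times> {..2 * h})"
  proof safe
    fix d :: nat assume d: "primepow d" "\<not> prime d" "d \<le> 4 ^ h"
    then obtain p j where pj: "prime p" "j > 0" "d = p ^ j"
      by (auto simp: primepow_def)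
    have "j \<noteq> 1" using pj d by auto
    with pj have j: "j \<ge> 2" by simp
    have p2: "p \<ge> 2" using pj prime_ge_2_nat by blast
    have "p ^ 2 \<le> p ^ j" using j p2 by (intro power_increasing) auto
    also have "\<dots> \<le> (2 ^ h) ^ 2" using d pj by (simp add: power2_eq_square flip: power_mult_distrib)
    finally have "p \<le> 2 ^ h" by (rule power2_le_imp_le) simp
    moreover have "(2::nat) ^ j \<le> p ^ j" using p2 by (intro power_mono) auto
    then have "(2::nat) ^ j \<le> 4 ^ h" using d pj by (metis order_trans)
    then have "(2::nat) ^ j \<le> 2 ^ (2 * h)" by (simp add: power_mult)
    then have "j \<le> 2 * h" by (simp add: power_increasing_iff)
    ultimately show "d \<in> (\<lambda>(p, j). p ^ j) ` ({..2 ^ h} \<times> {..2 * h})"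
      using pj by (auto intro!: image_eqI[of _ _ "(p, j)"])
  qed
  then have "card {d. primepow d \<and> \<not> prime d \<and> d \<le> (4::nat) ^ h} \<le>
      card ((\<lambda>(p, j). p ^ j) ` ({..(2::nat) ^ h} \<times> {..2 * h}))"
    by (intro card_mono) auto
  also have "\<dots> \<le> card ({..(2::nat) ^ h} \<times> {..2 * h})"
    by (intro card_image_le) auto
  finally show ?thesis by simp
qed

text \<open>
  Without a prime in the interval, only proper prime powers would contribute to
  \<open>\<psi>(4\<^sup>h\<^sup>+\<^sup>1) - \<psi>(4\<^sup>h)\<close>. That contribution is \<open>O(2\<^sup>h h\<^sup>2)\<close>, whereas the Chebyshev bounds force the
  difference to be at least about \<open>(2 \<cdot> 4\<^sup>h - 4\<^sup>h) ln 4\<close>.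
\<close>
lemma eventually_prime_between_powers_of_4:
  "\<forall>\<^sub>F h in sequentially. \<exists>q. prime q \<and> (4::nat) ^ h < q \<and> q \<le> 4 ^ Suc h"
proof -
  have "\<forall>\<^sub>F h in sequentially. (2 * real h + 2) + (2 * real h + 2) * ((2 * 2 ^ h + 1) * (2 * real h + 3)) < 2 * 4 ^ h"
    by real_asymp
  then show ?thesis
  proof eventually_elim
    case (elim h)
    show ?case
    proof (rule ccontr)
      assume none: "\<nexists>q. prime q \<and> (4::nat) ^ h < q \<and> q \<le> 4 ^ Suc h"
      define D where "D = {d. primepow d \<and> \<not> prime d \<and> d \<le> (4::nat) ^ Suc h}"
      have fin: "finite D" unfolding D_def by auto
      have ln4: "ln 4 = 2 * ln (2::real)"
        using ln_realpow[of 2 2] by simp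
      have "chebyshev_psi (4 ^ Suc h) - chebyshev_psi (4 ^ h) =
            (\<Sum>d\<in>{1..4 ^ Suc h} - {1..4 ^ h}. mangoldt d)"
        unfolding chebyshev_psi_def by (subst sum_diff) auto
      also have "\<dots> = (\<Sum>d\<in>D \<inter> {4 ^ h<..4 ^ Suc h}. mangoldt d)"
        using none by (intro sum.mono_neutral_right) (auto simp: D_def mangoldt_def not_le)
      also have "\<dots> \<le> (\<Sum>d\<in>D. mangoldt d)"
        using fin by (intro sum_mono2) (auto intro: mangoldt_nonneg)
      also have "\<dots> \<le> (\<Sum>d\<in>D. (2 * real h + 2) * ln 2)"
      proof (intro sum_mono)
        fix d assume d: "d \<in> D"
        then have "0 < d" by (auto simp: D_def intro: primepow_gt_0_nat)
        then have "(mangoldt d :: real) \<le> ln d"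
          by (rule mangoldt_le)
        also have "\<dots> \<le> ln (4 ^ Suc h)"
          using d \<open>0 < d\<close> of_nat_mono[of d "4 ^ Suc h", where ?'a = real]
          by (subst ln_le_cancel_iff) (auto simp: D_def)
        also have "\<dots> = (2 * real h + 2) * ln 2"
          by (subst ln_realpow) (auto simp: ln4 algebra_simps)
        finally show "mangoldt d \<le> (2 * real h + 2) * ln 2" .
      qed
      also have "\<dots> = real (card D) * ((2 * real h + 2) * ln 2)" by simp
      also have "\<dots> \<le> ((2 * 2 ^ h + 1) * (2 * real h + 3)) * ((2 * real h + 2) * ln 2)"
      proof (intro mult_right_mono)
        have "real (card D) \<le> real ((2 ^ Suc h + 1) * (2 * Suc h + 1))"
          using card_proper_primepows_le[of "Suc h"] unfolding D_def of_nat_le_iff .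
        then show "real (card D) \<le> (2 * 2 ^ h + 1) * (2 * real h + 3)"
          by (simp add: algebra_simps)
      qed auto
      finally have "chebyshev_psi (4 ^ Suc h) - chebyshev_psi (4 ^ h) \<le>
         ((2 * 2 ^ h + 1) * (2 * real h + 3)) * ((2 * real h + 2) * ln 2)" .
      moreover have "chebyshev_psi (4 ^ h) \<le> 4 ^ h * (2 * ln 2)"
        using chebyshev_psi_power2_le[of "2 * h"] by (simp add: power_mult ln4)
      moreover have "2 * 4 ^ h * (2 * ln 2) - (2 * real h + 2) * ln 2 \<le> chebyshev_psi (4 ^ Suc h)"
        using chebyshev_psi_power2_ge[of "2 * h + 1"] by (simp add: power_mult ln4 add.commute)
      ultimately have "(2 * 4 ^ h) * ln 2 \<le>
         ((2 * real h + 2) + (2 * real h + 2) * ((2 * 2 ^ h + 1) * (2 * real h + 3))) * ln (2::real)"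
        by (simp add: algebra_simps)
      with elim show False by simp
    qed
  qed
qed

section \<open>Counting independent sets in locally dense graphs\<close>

definition independent_sets :: "('a \<Rightarrow> 'a \<Rightarrow> bool) \<Rightarrow> 'a set \<Rightarrow> nat \<Rightarrow> 'a set set" where
  "independent_sets E U k = {I. I \<subseteq> U \<and> card I = k \<and> pairwise (\<lambda>x y. \<not> E x y) I}"

lemma finite_independent_sets: "finite U \<Longrightarrow> finite (independent_sets E U k)"
  unfolding independent_sets_def by (rule finite_subset[of _ "Pow U"]) auto

text \<open>
  The Kleitman-Winston bound. An independent set either avoids the vertex \<open>v\<close> of high degree, or
  contains \<open>v\<close> and otherwise lives among the non-neighbours of \<open>v\<close>, a set smaller by the factor
  \<open>\<gamma>\<close>. The second case can occur at most \<open>q\<close> times before the vertex set has shrunk to size \<open>R\<close>, where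
  the remaining elements are chosen arbitrarily. Read as a recursion for the number of independent
  sets, this is Pascal's rule for \<open>card U choose q\<close>.
\<close>
lemma card_independent_sets_le:
  fixes E :: "'a \<Rightarrow> 'a \<Rightarrow> bool" and \<gamma> :: real
  assumes "finite V" "\<gamma> > 0"
    and dense: "\<And>U. U \<subseteq> V \<Longrightarrow> R < card U \<Longrightarrow>
      \<exists>v\<in>U. real (card {y \<in> U. y \<noteq> v \<and> \<not> E v y}) \<le> \<gamma> * real (card U)"
    and "U \<subseteq> V" "\<gamma> ^ q * real (card U) \<le> real R"
  shows "card (independent_sets E U (q + r)) \<le> (card U choose q) * (R choose r)"
  using assms(4,5)
proof (induction "card U" arbitrary: U q rule: less_induct)
  case less
  have fin: "finite U" by (rule finite_subset[OF less.prems(1) \<open>finite V\<close>])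
  show ?case
  proof (cases "card U \<le> R")
    case True
    have "card (independent_sets E U (q + r)) \<le> card {I. I \<subseteq> U \<and> card I = q + r}"
      using fin by (intro card_mono) (auto simp: independent_sets_def)
    also have "\<dots> = card U choose (q + r)"
      by (rule n_subsets[OF fin])
    also have "\<dots> \<le> (card U choose q) * ((card U - q) choose r)"
    proof (cases "q + r \<le> card U")
      case le: True
      \<comment> \<open>Choosing the \<open>q\<close> elements first overcounts, which is harmless for an upper bound.\<close>
      have "1 * (card U choose (q + r)) \<le> ((q + r) choose q) * (card U choose (q + r))"
        by (intro mult_right_mono) (simp_all add: Suc_le_eq)
      also have "\<dots> = (card U choose q) * ((card U - q) choose r)"
        using choose_mult[of q "q + r" "card U"] le by (simp add: mult.commute)
      finally show ?thesis by simp
    qed (simp add: binomial_eq_0)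
    also have "\<dots> \<le> (card U choose q) * (R choose r)"
      using True by (intro mult_left_mono binomial_right_mono) auto
    finally show ?thesis .
  next
    case False
    then obtain q' where q: "q = Suc q'" using less.prems(2) by (cases q) auto
    obtain v where v: "v \<in> U"
      and deg: "real (card {y \<in> U. y \<noteq> v \<and> \<not> E v y}) \<le> \<gamma> * real (card U)"
      using dense[OF less.prems(1)] False by (meson not_le)
    define W where "W = {y \<in> U. y \<noteq> v \<and> \<not> E v y}"
    have W: "W \<subseteq> U - {v}" "finite W" using fin by (auto simp: W_def)
    define U' where "U' = U - {v}"
    have U': "finite U'" "U' \<subseteq> U" using fin by (auto simp: U'_def)
    have cU: "card U = Suc (card U')" unfolding U'_def by (rule card.remove[OF fin v])
    have cW: "card W \<le> card U'" using W fin unfolding U'_def by (intro card_mono) auto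
    have "independent_sets E U (q + r) \<subseteq>
        independent_sets E U' (q + r) \<union> insert v ` independent_sets E W (q' + r)"
    proof
      fix I assume I: "I \<in> independent_sets E U (q + r)"
      show "I \<in> independent_sets E U' (q + r) \<union> insert v ` independent_sets E W (q' + r)"
      proof (cases "v \<in> I")
        case True
        have "I - {v} \<in> independent_sets E W (q' + r)"
        proof -
          have sub: "I \<subseteq> U" and c: "card I = q + r" and pw: "pairwise (\<lambda>x y. \<not> E x y) I"
            using I by (simp_all add: independent_sets_def)
          have "I - {v} \<subseteq> W"
            using sub pairwiseD(1)[OF pw True] unfolding W_def by blast
          moreover have "card (I - {v}) = q' + r"
            using True c by (simp add: q)
          moreover have "pairwise (\<lambda>x y. \<not> E x y) (I - {v})"
            using pw by (rule pairwise_subset) auto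
          ultimately show ?thesis by (simp add: independent_sets_def)
        qed
        then show ?thesis using True by (intro UnI2 image_eqI[of _ _ "I - {v}"]) auto
      next
        case False
        then show ?thesis using I by (auto simp: independent_sets_def U'_def)
      qed
    qed
    then have "card (independent_sets E U (q + r)) \<le>
        card (independent_sets E U' (q + r) \<union> insert v ` independent_sets E W (q' + r))"
      using W U' by (intro card_mono finite_UnI finite_imageI finite_independent_sets) auto
    also have "\<dots> \<le> card (independent_sets E U' (q + r)) + card (independent_sets E W (q' + r))"
      by (intro order.trans[OF card_Un_le] add_mono card_image_le finite_independent_sets)
         (use W U' in auto)
    also have "\<dots> \<le> (card U' choose q) * (R choose r) + (card W choose q') * (R choose r)"
    proof (intro add_mono less.hyps)
      have "\<gamma> ^ q * real (card U') \<le> \<gamma> ^ q * real (card U)"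
        using cU \<open>\<gamma> > 0\<close> by (intro mult_left_mono) auto
      then show "\<gamma> ^ q * real (card U') \<le> real R"
        using less.prems(2) by linarith
      have "\<gamma> ^ q' * real (card W) \<le> \<gamma> ^ q' * (\<gamma> * real (card U))"
        using deg \<open>\<gamma> > 0\<close> unfolding W_def by (intro mult_left_mono) auto
      then show "\<gamma> ^ q' * real (card W) \<le> real R"
        using less.prems(2) by (simp add: q mult_ac)
    qed (use cU cW less.prems(1) W U' in auto)
    also have "\<dots> \<le> (card U' choose q) * (R choose r) + (card U' choose q') * (R choose r)"
      using cW by (intro add_mono mult_right_mono binomial_right_mono) auto
    also have "\<dots> = (card U choose q) * (R choose r)"
      by (simp add: cU q algebra_simps)
    finally show ?thesis .
  qed
qed

section \<open>The conflict graph of a Sidon set\<close>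

definition sidon_conflict :: "(nat \<Rightarrow> int) set \<Rightarrow> (nat \<Rightarrow> int) \<Rightarrow> (nat \<Rightarrow> int) \<Rightarrow> bool" where
  "sidon_conflict A x y \<longleftrightarrow> (\<exists>a\<in>A. \<exists>b\<in>A. (\<lambda>i. x i + a i) = (\<lambda>i. y i + b i))"

lemma sidonD:
  assumes "sidon S" "a \<in> S" "b \<in> S" "c \<in> S" "e \<in> S" "(\<lambda>i. a i + b i) = (\<lambda>i. c i + e i)"
  shows "{a, b} = {c, e}"
  using assms unfolding sidon_def by blast

lemma sidon_subset: "sidon S \<Longrightarrow> T \<subseteq> S \<Longrightarrow> sidon T"
  unfolding sidon_def by blast

lemma sidon_extension_independent:
  assumes "sidon (A \<union> I)" "A \<inter> I = {}"
  shows "pairwise (\<lambda>x y. \<not> sidon_conflict A x y) I"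
proof (rule pairwiseI, rule notI)
  fix x y assume xy: "x \<in> I" "y \<in> I" "x \<noteq> y" "sidon_conflict A x y"
  then obtain a b where ab: "a \<in> A" "b \<in> A" "(\<lambda>i. x i + a i) = (\<lambda>i. y i + b i)"
    by (auto simp: sidon_conflict_def)
  have "{x, a} = {y, b}"
    using sidonD[OF assms(1) _ _ _ _ ab(3)] xy ab by auto
  with xy(3) have "x = b" by (auto simp: doubleton_eq_iff)
  with xy ab assms(2) show False by auto
qed

lemma add_grid:
  assumes "x \<in> grid d n" "y \<in> grid d n"
  shows "(\<lambda>i. x i + y i) \<in> grid d (2 * n)"
proof -
  have "0 \<le> x i + y i \<and> x i + y i \<le> int (2 * n) - 1" if "i < d" for i
  proof -
    have "x i \<in> {0..int n - 1}" "y i \<in> {0..int n - 1}"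
      using assms that by (auto simp: grid_def PiE_dflt_def)
    then show ?thesis by auto
  qed
  moreover have "x i + y i = 0" if "\<not> i < d" for i
    using assms that by (auto simp: grid_def PiE_dflt_def)
  ultimately show ?thesis
    by (auto simp: grid_def PiE_dflt_def)
qed

lemma sum_power2_card_fibres:
  assumes "finite P" "f ` P \<subseteq> Z" "finite Z"
  shows "(\<Sum>z\<in>Z. (card {u\<in>P. f u = z})\<^sup>2) = card {(u, w). u \<in> P \<and> w \<in> P \<and> f u = f w}"
proof -
  have "{(u, w). u \<in> P \<and> w \<in> P \<and> f u = f w} = (\<Union>z\<in>Z. {u\<in>P. f u = z} \<times> {u\<in>P. f u = z})"
    using assms by auto
  also have "card \<dots> = (\<Sum>z\<in>Z. card ({u\<in>P. f u = z} \<times> {u\<in>P. f u = z}))"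
    using assms by (intro card_UN_disjoint) auto
  finally show ?thesis by (simp add: card_cartesian_product power2_eq_square)
qed

text \<open>
  Cauchy-Schwarz for the sizes of the fibres of \<open>f\<close>.
\<close>
lemma card_power2_le_card_collisions:
  assumes "finite P" "f ` P \<subseteq> Z" "finite Z"
  shows "(card P)\<^sup>2 \<le> card Z * card {(u, w). u \<in> P \<and> w \<in> P \<and> f u = f w}"
proof -
  have "card P = (\<Sum>z\<in>Z. card {u\<in>P. f u = z})"
    using sum.group[OF assms(1,3,2), of "\<lambda>_. 1 :: nat"] by simp
  then have "(real (card P))\<^sup>2 = (\<Sum>z\<in>Z. real (card {u\<in>P. f u = z}))\<^sup>2" by simp
  also have "\<dots> \<le> (\<Sum>z\<in>Z. (real (card {u\<in>P. f u = z}))\<^sup>2) * card Z"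
    using assms by (intro sum_squared_le_sum_of_squares)
  also have "\<dots> = real (card Z * (\<Sum>z\<in>Z. (card {u\<in>P. f u = z})\<^sup>2))"
    by simp
  finally have "real ((card P)\<^sup>2) \<le> real (card Z * (\<Sum>z\<in>Z. (card {u\<in>P. f u = z})\<^sup>2))"
    by simp
  then show ?thesis unfolding of_nat_le_iff sum_power2_card_fibres[OF assms] .
qed

text \<open>
  The \<open>card U * card A\<close> sums \<open>x + a\<close> all lie in a grid of side \<open>2n\<close>, which has only
  \<open>2\<^sup>d n\<^sup>d\<close> points, so Cauchy-Schwarz produces many coincidences \<open>x + a = y + b\<close>. Those with \<open>x = y\<close>
  account for at most half of them when \<open>U\<close> is large. Since \<open>A\<close> is a Sidon set, the difference
  \<open>x - y = b - a\<close>, if it is not zero, determines \<open>a\<close> and \<open>b\<close>; so distinct coincidences with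
  \<open>x \<noteq> y\<close> give distinct ordered edges of the conflict graph, and some vertex has at least the
  average degree.
\<close>
lemma exists_vertex_of_high_conflict_degree:
  assumes "A \<subseteq> grid d n" "sidon A" "U \<subseteq> grid d n" "U \<noteq> {}"
    and large: "2 ^ (d + 1) * n ^ d \<le> card U * card A"
  shows "\<exists>v\<in>U. (card A)\<^sup>2 * card U \<le>
           2 ^ (d + 1) * n ^ d * card {y \<in> U. y \<noteq> v \<and> sidon_conflict A v y}"
proof (rule ccontr)
  define deg where "deg v = card {y \<in> U. y \<noteq> v \<and> sidon_conflict A v y}" for v
  define K where "K = 2 ^ d * n ^ d"
  assume "\<not> ?thesis"
  then have less: "2 * K * deg v < (card A)\<^sup>2 * card U" if "v \<in> U" for v
    using that by (auto simp: deg_def K_def not_le mult_ac)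
  have fin: "finite U" "finite A" using assms by (auto intro: finite_subset)
  define f :: "(nat \<Rightarrow> int) \<times> (nat \<Rightarrow> int) \<Rightarrow> nat \<Rightarrow> int" where "f = (\<lambda>(x, a) i. x i + a i)"
  define C where "C = {(u, w). u \<in> U \<times> A \<and> w \<in> U \<times> A \<and> f u = f w}"
  have finC: "finite C"
    unfolding C_def by (rule finite_subset[of _ "(U \<times> A) \<times> (U \<times> A)"]) (use fin in auto)
  have "(card (U \<times> A))\<^sup>2 \<le> card (grid d (2 * n)) * card C"
    unfolding C_def using fin assms
    by (intro card_power2_le_card_collisions) (auto simp: f_def intro!: add_grid)
  then have cs: "(card U * card A)\<^sup>2 \<le> K * card C"
    by (simp add: card_grid K_def power_mult_distrib card_cartesian_product)
  define D where "D = C \<inter> {(u, w). fst u = fst w}"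
  have "D \<subseteq> (\<lambda>u. (u, u)) ` (U \<times> A)"
  proof
    fix z assume "z \<in> D"
    then obtain x a b where z: "z = ((x, a), (x, b))" "x \<in> U" "a \<in> A" "f (x, a) = f (x, b)"
      by (auto simp: D_def C_def)
    then have "a = b" by (auto simp: f_def fun_eq_iff)
    with z show "z \<in> (\<lambda>u. (u, u)) ` (U \<times> A)" by auto
  qed
  then have "card D \<le> card ((\<lambda>u. (u, u)) ` (U \<times> A))"
    using fin by (intro card_mono) auto
  also have "\<dots> \<le> card U * card A"
    using card_image_le[of "U \<times> A" "\<lambda>u. (u, u)"] fin by (simp add: card_cartesian_product)
  finally have D: "card D \<le> card U * card A" .
  \<comment> \<open>The Sidon property makes the projection of a coincidence to its edge injective.\<close>
  have "card (C - D) = card ((\<lambda>(u, w). (fst u, fst w)) ` (C - D))"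
  proof (rule card_image [symmetric], rule inj_onI, clarsimp)
    fix x a y b a' b'
    assume 1: "((x, a), (y, b)) \<in> C" "((x, a), (y, b)) \<notin> D" "((x, a'), (y, b')) \<in> C"
    then have mem: "a \<in> A" "b \<in> A" "a' \<in> A" "b' \<in> A" and ne: "x \<noteq> y"
      and e1: "\<And>i. x i + a i = y i + b i" and e2: "\<And>i. x i + a' i = y i + b' i"
      by (auto simp: C_def D_def f_def fun_eq_iff)
    have "a i + b' i = a' i + b i" for i using e1[of i] e2[of i] by linarith
    then have "{a, b'} = {a', b}"
      by (intro sidonD[OF assms(2)] mem ext)
    moreover have "a \<noteq> b"
    proof
      assume "a = b"
      then have "x i = y i" for i using e1[of i] by simp
      with ne show False by blast
    qed
    ultimately show "a = a' \<and> b = b'" unfolding doubleton_eq_iff by blast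
  qed
  also have "\<dots> \<le> card (SIGMA v:U. {y \<in> U. y \<noteq> v \<and> sidon_conflict A v y})"
  proof (intro card_mono)
    show "(\<lambda>(u, w). (fst u, fst w)) ` (C - D) \<subseteq> (SIGMA v:U. {y \<in> U. y \<noteq> v \<and> sidon_conflict A v y})"
    proof
      fix z assume "z \<in> (\<lambda>(u, w). (fst u, fst w)) ` (C - D)"
      then obtain x a y b where "z = (x, y)" "((x, a), (y, b)) \<in> C" "((x, a), (y, b)) \<notin> D"
        by auto
      then show "z \<in> (SIGMA v:U. {y \<in> U. y \<noteq> v \<and> sidon_conflict A v y})"
        by (simp add: C_def D_def f_def sidon_conflict_def) blast
    qed
  qed (use fin in auto)
  also have "\<dots> = (\<Sum>v\<in>U. deg v)"
    unfolding deg_def using fin by (intro card_SigmaI) auto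
  finally have CD: "card (C - D) \<le> (\<Sum>v\<in>U. deg v)" .
  have "card C = card D + card (C - D)"
    using card_Int_Diff[OF finC, of "{(u, w). fst u = fst w}"] by (simp add: D_def Diff_Int)
  with D CD have "card C \<le> card U * card A + (\<Sum>v\<in>U. deg v)" by linarith
  then have 1: "K * card C \<le> K * (card U * card A) + K * (\<Sum>v\<in>U. deg v)"
    by (metis add_mult_distrib2 mult_le_mono2)
  have 2: "2 * (K * (card U * card A)) \<le> (card U * card A)\<^sup>2"
    using mult_right_mono[OF large, of "card U * card A"]
    by (simp only: K_def power2_eq_square power_add power_one_right mult_ac)
  have 3: "2 * (K * (\<Sum>v\<in>U. deg v)) < (card U * card A)\<^sup>2"
  proof -
    have "2 * (K * (\<Sum>v\<in>U. deg v)) = (\<Sum>v\<in>U. 2 * K * deg v)"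
      by (simp only: sum_distrib_left mult.assoc)
    also have "\<dots> < (\<Sum>v\<in>U. (card A)\<^sup>2 * card U)"
      using less fin assms(4) by (intro sum_strict_mono)
    also have "\<dots> = (card U * card A)\<^sup>2"
      by (simp only: sum_constant power2_eq_square mult_ac of_nat_id)
    finally show ?thesis .
  qed
  have "k \<le> x + y \<Longrightarrow> 2 * x \<le> e \<Longrightarrow> 2 * y < e \<Longrightarrow> e \<le> k \<Longrightarrow> False" for k x y e :: nat
    by linarith
  from this [OF 1 2 3 cs] show False .
qed

section \<open>The number of Sidon sets of a given size\<close>

definition sidon_sets :: "nat \<Rightarrow> nat \<Rightarrow> nat \<Rightarrow> (nat \<Rightarrow> int) set set" where
  "sidon_sets d n k = {S. S \<subseteq> grid d n \<and> sidon S \<and> card S = k}"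

lemma finite_sidon_sets [simp]: "finite (sidon_sets d n k)"
  unfolding sidon_sets_def by (rule finite_subset[of _ "Pow (grid d n)"]) auto

lemma power_self_le_exp_fact: "real r ^ r \<le> exp (real r) * fact r"
proof -
  have "(\<Sum>k\<in>{r}. real r ^ k / fact k) \<le> (\<Sum>k. real r ^ k / fact k)"
    using summable_exp[of "real r"] by (intro sum_le_suminf) (auto simp: field_simps)
  also have "\<dots> = exp (real r)"
    by (simp add: exp_def field_simps)
  finally show ?thesis by (simp add: field_simps)
qed

lemma binomial_le_power:
  assumes "r > 0"
  shows "real (n choose r) \<le> (3 * real n / real r) ^ r"
proof -
  have "real (n choose r) * real r ^ r \<le> real (n choose r) * (exp (real r) * fact r)"
    by (intro mult_left_mono power_self_le_exp_fact) auto
  also have "\<dots> = exp (real r) * real ((n choose r) * fact r)" by simp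
  also have "\<dots> \<le> exp (real r) * real (n ^ r)"
    using binomial_fact_pow[of n r] by (intro mult_left_mono) (simp_all only: of_nat_le_iff exp_ge_zero)
  also have "exp (real r) = exp 1 ^ r" by (simp flip: exp_of_nat_mult)
  also have "\<dots> \<le> 3 ^ r" using exp_le by (intro power_mono) auto
  finally have "real (n choose r) * real r ^ r \<le> (3 * real n) ^ r"
    by (simp add: power_mult_distrib mult_right_mono)
  then show ?thesis using assms by (simp add: power_divide pos_le_divide_eq)
qed

text \<open>
  Any half of a Sidon set is a Sidon set, and the other half is independent in its conflict graph.
  A set of size \<open>2s\<close> is thus reached from each of its halves; counting it only once would gain a
  factor that does not matter.
\<close>
lemma card_sidon_sets_double_le:
  assumes ext: "\<And>A. A \<in> sidon_sets d n s \<Longrightarrow>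
      card (independent_sets (sidon_conflict A) (grid d n) s) \<le> B"
  shows "card (sidon_sets d n (2 * s)) \<le> card (sidon_sets d n s) * B"
proof -
  let ?I = "\<lambda>A. independent_sets (sidon_conflict A) (grid d n) s"
  have "sidon_sets d n (2 * s) \<subseteq> (\<Union>A\<in>sidon_sets d n s. (\<lambda>I. A \<union> I) ` ?I A)"
  proof
    fix S assume S: "S \<in> sidon_sets d n (2 * s)"
    then have fin: "finite S" by (auto simp: sidon_sets_def intro: finite_subset[OF _ finite_grid])
    have "s \<le> card S" using S by (simp add: sidon_sets_def)
    then obtain A where A: "A \<subseteq> S" "card A = s"
      using obtain_subset_with_card_n by metis
    have "A \<in> sidon_sets d n s"
      using A S sidon_subset by (auto simp: sidon_sets_def)
    moreover have "S - A \<in> ?I A"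
    proof -
      have "card (S - A) = s"
        using A S fin by (subst card_Diff_subset) (auto simp: sidon_sets_def intro: finite_subset)
      moreover have "pairwise (\<lambda>x y. \<not> sidon_conflict A x y) (S - A)"
        using A S by (intro sidon_extension_independent) (auto simp: sidon_sets_def Un_absorb1)
      ultimately show ?thesis
        using S by (auto simp: independent_sets_def sidon_sets_def)
    qed
    moreover have "S = A \<union> (S - A)" using A by auto
    ultimately show "S \<in> (\<Union>A\<in>sidon_sets d n s. (\<lambda>I. A \<union> I) ` ?I A)" by blast
  qed
  then have "card (sidon_sets d n (2 * s)) \<le> card (\<Union>A\<in>sidon_sets d n s. (\<lambda>I. A \<union> I) ` ?I A)"
    by (intro card_mono) (auto intro!: finite_independent_sets)
  also have "\<dots> \<le> (\<Sum>A\<in>sidon_sets d n s. card ((\<lambda>I. A \<union> I) ` ?I A))"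
    by (intro card_UN_le) auto
  also have "\<dots> \<le> (\<Sum>A\<in>sidon_sets d n s. B)"
    by (intro sum_mono order.trans[OF card_image_le ext] finite_independent_sets) auto
  finally show ?thesis by simp
qed

text \<open>
  The bound on independent sets with \<open>R\<close> about \<open>2\<^sup>d\<^sup>+\<^sup>1 N / s\<close> and \<open>\<gamma> = exp (- s\<^sup>2 / (2\<^sup>d\<^sup>+\<^sup>1 N))\<close>: the
  hypothesis on \<open>q\<close> makes \<open>\<gamma>\<^sup>q N \<le> 1\<close>. As at least \<open>s / 2\<close> elements are then chosen from \<open>R\<close>
  vertices, each of them contributes a factor of at most \<open>2\<^sup>d\<^sup>+\<^sup>4 N / s\<^sup>2\<close>. The bound also holds for
  large \<open>s\<close>, where this factor drops below 1: then \<open>R\<close> is too small to supply the \<open>s - q\<close> elements, and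
  the binomial coefficient vanishes.
\<close>
lemma card_extensions_le:
  assumes A: "A \<in> sidon_sets d n s" and s: "s > 0" and qs: "2 * q \<le> s"
    and q: "2 ^ (d + 1) * real (n ^ d) * ln (real (n ^ d)) \<le> real q * (real s)\<^sup>2"
  shows "real (card (independent_sets (sidon_conflict A) (grid d n) s)) \<le>
           real (n ^ d) ^ q * (2 ^ (d + 4) * real (n ^ d) / (real s)\<^sup>2) ^ s"
proof -
  define N where "N = n ^ d"
  define R where "R = (2 ^ (d + 1) * N) div s"
  define \<gamma> where "\<gamma> = exp (- ((real s)\<^sup>2 / (2 ^ (d + 1) * real N)))"
  have A': "A \<subseteq> grid d n" "sidon A" "card A = s" using A by (auto simp: sidon_sets_def)
  have sN: "s \<le> N" using A' card_mono[OF finite_grid A'(1)] by (simp add: card_grid N_def)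
  have N: "N > 0" using s sN by simp
  have R1: "1 \<le> R"
  proof -
    have "s \<le> 2 ^ (d + 1) * N" using sN by (simp add: order_trans)
    then show ?thesis using s by (simp add: R_def div_greater_zero_iff Suc_le_eq)
  qed
  have "card (independent_sets (sidon_conflict A) (grid d n) (q + (s - q))) \<le>
      (card (grid d n) choose q) * (R choose (s - q))"
  proof (rule card_independent_sets_le)
    show "\<gamma> > 0" by (simp add: \<gamma>_def)
    show "\<gamma> ^ q * real (card (grid d n)) \<le> real R"
    proof -
      have "ln (real N) \<le> real q * ((real s)\<^sup>2 / (2 ^ (d + 1) * real N))"
        using q N by (simp add: N_def[symmetric] field_simps)
      then have "\<gamma> ^ q \<le> exp (- ln (real N))"
        unfolding \<gamma>_def by (simp flip: exp_of_nat_mult)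
      also have "\<dots> = 1 / real N" using N by (simp add: exp_minus field_simps)
      finally have "\<gamma> ^ q * real N \<le> 1" using N by (simp add: field_simps)
      then show ?thesis using R1 by (simp add: card_grid N_def)
    qed
    fix U assume U: "U \<subseteq> grid d n" "R < card U"
    have "2 ^ (d + 1) * N < card U * s"
      using U(2) s unfolding R_def by (simp add: div_less_iff_less_mult)
    then obtain v where v: "v \<in> U" and deg: "s\<^sup>2 * card U \<le>
        2 ^ (d + 1) * N * card {y \<in> U. y \<noteq> v \<and> sidon_conflict A v y}" (is "_ \<le> _ * card ?D")
    proof -
      have "U \<noteq> {}" using U(2) by auto
      moreover have "2 ^ (d + 1) * n ^ d \<le> card U * card A"
        using \<open>2 ^ (d + 1) * N < card U * s\<close> by (simp add: A'(3) N_def)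
      ultimately show ?thesis
        using exists_vertex_of_high_conflict_degree[OF A'(1,2) U(1)] that
        unfolding A'(3) N_def by blast
    qed
    have finU: "finite U" using U finite_subset[OF _ finite_grid] by blast
    have "real (s\<^sup>2 * card U) \<le> real (2 ^ (d + 1) * N * card ?D)"
      using deg unfolding of_nat_le_iff .
    then have "(real s)\<^sup>2 / (2 ^ (d + 1) * real N) * real (card U) \<le> real (card ?D)"
      using N by (simp add: field_simps)
    moreover have "card {y \<in> U. y \<noteq> v \<and> \<not> sidon_conflict A v y} + card ?D \<le> card U"
    proof -
      have "card {y \<in> U. y \<noteq> v \<and> \<not> sidon_conflict A v y} + card ?D =
          card ({y \<in> U. y \<noteq> v \<and> \<not> sidon_conflict A v y} \<union> ?D)"
        using finU by (intro card_Un_disjoint [symmetric]) auto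
      also have "\<dots> \<le> card U" using finU by (intro card_mono) auto
      finally show ?thesis .
    qed
    then have "real (card {y \<in> U. y \<noteq> v \<and> \<not> sidon_conflict A v y}) + real (card ?D) \<le> real (card U)"
      unfolding of_nat_add [symmetric] of_nat_le_iff .
    ultimately have "real (card {y \<in> U. y \<noteq> v \<and> \<not> sidon_conflict A v y}) \<le>
        (1 - (real s)\<^sup>2 / (2 ^ (d + 1) * real N)) * real (card U)"
      by (simp only: left_diff_distrib mult_1_left)
    also have "\<dots> \<le> \<gamma> * real (card U)"
      unfolding \<gamma>_def using exp_ge_add_one_self[of "- ((real s)\<^sup>2 / (2 ^ (d + 1) * real N))"]
      by (intro mult_right_mono) auto
    finally show "\<exists>v\<in>U. real (card {y \<in> U. y \<noteq> v \<and> \<not> sidon_conflict A v y}) \<le> \<gamma> * real (card U)"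
      using v by blast
  qed auto
  then have "real (card (independent_sets (sidon_conflict A) (grid d n) (q + (s - q)))) \<le>
      real ((N choose q) * (R choose (s - q)))"
    unfolding of_nat_le_iff by (simp add: card_grid N_def)
  also have "\<dots> \<le> real N ^ q * (2 ^ (d + 4) * real N / (real s)\<^sup>2) ^ s"
    unfolding of_nat_mult
  proof (intro mult_mono)
    show "real (N choose q) \<le> real N ^ q"
    proof (cases "q \<le> N")
      case True
      then show ?thesis by (metis binomial_le_pow of_nat_le_iff of_nat_power)
    qed (simp add: binomial_eq_0)
    show "real (R choose (s - q)) \<le> (2 ^ (d + 4) * real N / (real s)\<^sup>2) ^ s"
    proof (cases "s - q \<le> R")
      case False
      then show ?thesis by (simp add: binomial_eq_0)
    next
      case True
      have r: "real s / 2 \<le> real (s - q)" "0 < s - q"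
        using qs s by auto
      have "R * s \<le> 2 ^ (d + 1) * N" by (simp add: R_def)
      then have Rs: "real R * real s \<le> 2 ^ (d + 1) * real N"
        by (metis of_nat_le_iff of_nat_mult of_nat_numeral of_nat_power)
      have "3 * real R / real (s - q) \<le> 3 * real R / (real s / 2)"
        using r s by (intro divide_left_mono) auto
      also have "\<dots> \<le> 8 * real R / real s" using s by (simp add: field_simps)
      also have "\<dots> = 8 * (real R * real s) / (real s)\<^sup>2"
        using s by (simp add: power2_eq_square)
      also have "\<dots> \<le> 8 * (2 ^ (d + 1) * real N) / (real s)\<^sup>2"
        using Rs by (intro divide_right_mono mult_left_mono) auto
      also have "\<dots> = 2 ^ (d + 4) * real N / (real s)\<^sup>2"
        by (simp add: power_add)
      finally have base: "3 * real R / real (s - q) \<le> 2 ^ (d + 4) * real N / (real s)\<^sup>2" .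
      \<comment> \<open>A base of at least 1 permits raising the exponent from \<open>s - q\<close> to \<open>s\<close>.\<close>
      have "1 \<le> 3 * real R / real (s - q)"
        using True r by (simp add: field_simps)
      from this base have one: "1 \<le> 2 ^ (d + 4) * real N / (real s)\<^sup>2" by (rule order_trans)
      have "real (R choose (s - q)) \<le> (3 * real R / real (s - q)) ^ (s - q)"
        by (rule binomial_le_power) fact
      also have "\<dots> \<le> (2 ^ (d + 4) * real N / (real s)\<^sup>2) ^ (s - q)"
        using base by (intro power_mono) auto
      also have "\<dots> \<le> (2 ^ (d + 4) * real N / (real s)\<^sup>2) ^ s"
        using one by (intro power_increasing) auto
      finally show ?thesis .
    qed
  qed auto
  finally show ?thesis using qs by (simp add: N_def)
qed

lemma card_sidon_sets_step:
  assumes "s > 0" and "2 * q \<le> s"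
    and "2 ^ (d + 1) * real (n ^ d) * ln (real (n ^ d)) \<le> real q * (real s)\<^sup>2"
  shows "real (card (sidon_sets d n (2 * s))) \<le> real (card (sidon_sets d n s)) *
           (real (n ^ d) ^ q * (2 ^ (d + 4) * real (n ^ d) / (real s)\<^sup>2) ^ s)"
    (is "_ \<le> _ * ?X")
proof -
  have "card (independent_sets (sidon_conflict A) (grid d n) s) \<le> nat \<lfloor>?X\<rfloor>"
    if "A \<in> sidon_sets d n s" for A
    using card_extensions_le[OF that assms] by (simp add: le_nat_floor)
  then have "card (sidon_sets d n (2 * s)) \<le> card (sidon_sets d n s) * nat \<lfloor>?X\<rfloor>"
    by (rule card_sidon_sets_double_le)
  then have "real (card (sidon_sets d n (2 * s))) \<le> real (card (sidon_sets d n s)) * real (nat \<lfloor>?X\<rfloor>)"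
    unfolding of_nat_mult [symmetric] of_nat_le_iff .
  also have "\<dots> \<le> real (card (sidon_sets d n s)) * ?X"
    by (intro mult_left_mono of_nat_floor) auto
  finally show ?thesis .
qed

text \<open>
  Iterating the doubling step from size \<open>2\<^sup>j\<close>, where \<open>2\<^sup>j\<close> is at least of order \<open>(N ln N)\<^sup>1\<^sup>/\<^sup>3\<close>. The
  constant \<open>2\<^sup>d\<^sup>+\<^sup>8\<close> is 16 times that of a single step, because
  \<open>(16 C N / 4\<^sup>k) (C N / 4\<^sup>k) = (16 C N / 4\<^sup>k\<^sup>+\<^sup>1)\<^sup>2\<close>
  reproduces the bound exactly. The exponent of \<open>N\<close> collects \<open>2\<^sup>j\<close> for the starting set and the
  numbers \<open>q \<le> 8\<^sup>j / 4\<^sup>k\<^sup>+\<^sup>1\<close> of free choices, whose geometric sum is at most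
  \<open>2\<^sup>j - 8\<^sup>j / 4\<^sup>m\<close>. The last hypothesis ensures that rounding \<open>q\<close> up at most doubles it.
\<close>
lemma card_sidon_sets_le:
  fixes d n j m :: nat and y :: real
  defines "y \<equiv> 2 ^ (d + 1) * real (n ^ d) * ln (real (n ^ d))"
  assumes n: "n > 0" and j: "8 * y \<le> 8 ^ j" and "j \<le> m" and m: "\<And>k. k < m \<Longrightarrow> 4 ^ k \<le> y"
  shows "real (card (sidon_sets d n (2 ^ m))) \<le>
           real (n ^ d) powr (2 * 2 ^ j - 8 ^ j / 4 ^ m) * (2 ^ (d + 8) * real (n ^ d) / 4 ^ m) ^ (2 ^ m)"
  using \<open>j \<le> m\<close> m
proof (induction m rule: dec_induct)
  define N where "N = n ^ d"
  have N: "N \<ge> 1" using n by (simp add: N_def)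
  have half: "(2::real) * 2 ^ j - 8 ^ j / 4 ^ j = 2 ^ j"
    by (simp flip: power_divide)
  {
    case base
    define s where "s = (2::nat) ^ j"
    have s: "s > 0" by (simp add: s_def)
    have "real (card (sidon_sets d n s)) \<le> real (N choose s)"
    proof -
      have "card (sidon_sets d n s) \<le> card {S. S \<subseteq> grid d n \<and> card S = s}"
        by (intro card_mono) (auto simp: sidon_sets_def)
      also have "\<dots> = N choose s" by (simp add: n_subsets card_grid N_def)
      finally show ?thesis by simp
    qed
    also have "\<dots> \<le> real N ^ s * (2 ^ (d + 8) * real N / (real s)\<^sup>2) ^ s"
    proof (cases "s \<le> N")
      case True
      have "real (N choose s) \<le> (3 * real N / real s) ^ s"
        using s by (rule binomial_le_power)
      also have "\<dots> \<le> (real N * (2 ^ (d + 8) * real N / (real s)\<^sup>2)) ^ s"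
      proof (intro power_mono)
        have "3 * real s \<le> 2 ^ (d + 8) * real N"
          using True by (intro mult_mono) (auto simp: power_add intro: order_trans[of _ "1 * 256"])
        then show "3 * real N / real s \<le> real N * (2 ^ (d + 8) * real N / (real s)\<^sup>2)"
          using s N by (simp add: field_simps power2_eq_square)
      qed auto
      finally show ?thesis by (simp only: power_mult_distrib)
    qed (simp add: binomial_eq_0)
    finally have "real (card (sidon_sets d n s)) \<le> real N ^ s * (2 ^ (d + 8) * real N / (real s)\<^sup>2) ^ s" .
    moreover have "real N ^ s = real N powr (2 * 2 ^ j - 8 ^ j / 4 ^ j)"
      unfolding half using N by (subst powr_realpow [symmetric]) (auto simp: s_def)
    moreover have "(real s)\<^sup>2 = 4 ^ j"
      by (simp add: s_def power2_eq_square flip: power_mult_distrib)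
    ultimately show ?case
      by (simp only: N_def [symmetric] s_def)
  next
    case (step k)
    define s where "s = (2::nat) ^ k"
    have s: "s > 0" by (simp add: s_def)
    have s2: "(real s)\<^sup>2 = 4 ^ k"
      by (simp add: s_def power2_eq_square flip: power_mult_distrib)
    define q where "q = nat \<lceil>y / 4 ^ k\<rceil>"
    have yk: "1 \<le> y / 4 ^ k" using step.prems[of k] by (simp add: field_simps)
    have q_ge: "y / 4 ^ k \<le> real q" unfolding q_def by (rule real_nat_ceiling_ge)
    have "real q \<le> y / 4 ^ k + 1" using yk unfolding q_def by linarith
    also have "\<dots> \<le> 2 * (y / 4 ^ k)" using yk by linarith
    also have "\<dots> \<le> 2 * (8 ^ j / 8) / 4 ^ k"
      using j by (simp add: field_simps)
    finally have q_le: "real q \<le> 8 ^ j / 4 ^ k / 4" by simp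
    have "(8::real) ^ j / 4 ^ k \<le> 8 ^ k / 4 ^ k"
      using step.hyps by (intro divide_right_mono power_increasing) auto
    also have "\<dots> = 2 ^ k" by (simp flip: power_divide)
    finally have "(8::real) ^ j / 4 ^ k / 4 \<le> 2 ^ k / 4" by (rule divide_right_mono) simp
    with q_le have "real q \<le> 2 ^ k / 4" by (rule order_trans)
    also have "\<dots> \<le> real s / 2" by (simp add: s_def)
    finally have q2: "2 * q \<le> s" by linarith
    have qs: "2 ^ (d + 1) * real (n ^ d) * ln (real (n ^ d)) \<le> real q * (real s)\<^sup>2"
      using q_ge unfolding s2 y_def by (simp add: field_simps)
    let ?e = "2 * 2 ^ j - 8 ^ j / 4 ^ k :: real" and ?e' = "2 * 2 ^ j - 8 ^ j / 4 ^ Suc k :: real"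
    let ?b = "2 ^ (d + 8) * real N / 4 ^ k"
    have "real N powr ?e * real N ^ q = real N powr (?e + real q)"
      using N by (simp add: powr_add powr_realpow)
    also have "\<dots> \<le> real N powr ?e'"
    proof (rule powr_mono)
      define X where "X = (8::real) ^ j / 4 ^ k"
      have "X \<ge> 0" "8 ^ j / 4 ^ Suc k = X / 4" by (simp_all add: X_def)
      moreover have "real q \<le> X / 4" using q_le by (simp only: X_def)
      ultimately show "?e + real q \<le> ?e'" unfolding X_def [symmetric] by linarith
      show "1 \<le> real N" using N by simp
    qed
    finally have exponent: "real N powr ?e * real N ^ q \<le> real N powr ?e'" .
    have "real (card (sidon_sets d n (2 ^ Suc k))) \<le> real (card (sidon_sets d n s)) *
           (real N ^ q * (2 ^ (d + 4) * real N / 4 ^ k) ^ s)"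
      using card_sidon_sets_step[OF s q2 qs, unfolded s2] by (simp only: N_def s_def power_Suc)
    also have "\<dots> \<le> (real N powr ?e * ?b ^ s) * (real N ^ q * (2 ^ (d + 4) * real N / 4 ^ k) ^ s)"
    proof (intro mult_right_mono)
      show "real (card (sidon_sets d n s)) \<le> real N powr ?e * ?b ^ s"
        unfolding N_def s_def using step.prems by (intro step.IH) auto
    qed auto
    also have "\<dots> = (real N powr ?e * real N ^ q) * (?b * (2 ^ (d + 4) * real N / 4 ^ k)) ^ s"
      by (simp only: power_mult_distrib mult_ac)
    also have "\<dots> \<le> real N powr ?e' * (?b * (2 ^ (d + 4) * real N / 4 ^ k)) ^ s"
      by (rule mult_right_mono[OF exponent]) simp
    also have "?b * (2 ^ (d + 4) * real N / 4 ^ k) = (2 ^ (d + 8) * real N / 4 ^ Suc k)\<^sup>2"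
      by (simp add: power2_eq_square power_add)
    also have "((2 ^ (d + 8) * real N / 4 ^ Suc k)\<^sup>2) ^ s = (2 ^ (d + 8) * real N / 4 ^ Suc k) ^ (2 ^ Suc k)"
      by (simp only: power_mult [symmetric] s_def power_Suc)
    finally show ?case by (simp add: N_def)
  }
qed

section \<open>Random subsets of the grid and their largest Sidon sets\<close>

lemma prob_random_grid_superset:
  assumes "T \<subseteq> grid d n" "0 \<le> q" "q \<le> 1"
  shows "measure_pmf.prob (random_grid d n q) {A. T \<subseteq> A} = q ^ card T"
proof -
  define B where "B x = (if x \<in> T then {True} else UNIV)" for x
  have "measure_pmf.prob (random_grid d n q) {A. T \<subseteq> A} =
        measure_pmf.prob (Pi_pmf (grid d n) False (\<lambda>_. bernoulli_pmf q)) (Pi (grid d n) B)"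
    unfolding random_grid_def measure_map_pmf using assms(1)
    by (intro arg_cong2[of _ _ _ _ measure] refl) (auto simp: B_def Pi_iff split: if_splits)
  also have "\<dots> = (\<Prod>x\<in>grid d n. measure_pmf.prob (bernoulli_pmf q) (B x))"
    by (rule measure_Pi_pmf_Pi) auto
  also have "\<dots> = (\<Prod>x\<in>T. q)"
    using assms by (intro prod.mono_neutral_cong_right) (auto simp: B_def measure_pmf_single)
  finally show ?thesis by simp
qed

lemma prob_random_grid_avoid:
  assumes "T \<subseteq> grid d n" "0 \<le> q" "q \<le> 1"
  shows "measure_pmf.prob (random_grid d n q) {A. A \<inter> T = {}} = (1 - q) ^ card T"
proof -
  define B where "B x = (if x \<in> T then {False} else UNIV)" for x
  have "measure_pmf.prob (random_grid d n q) {A. A \<inter> T = {}} =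
        measure_pmf.prob (Pi_pmf (grid d n) False (\<lambda>_. bernoulli_pmf q)) (Pi (grid d n) B)"
    unfolding random_grid_def measure_map_pmf using assms(1)
    by (intro arg_cong2[of _ _ _ _ measure] refl) (auto simp: B_def Pi_iff split: if_splits)
  also have "\<dots> = (\<Prod>x\<in>grid d n. measure_pmf.prob (bernoulli_pmf q) (B x))"
    by (rule measure_Pi_pmf_Pi) auto
  also have "\<dots> = (\<Prod>x\<in>T. 1 - q)"
    using assms by (intro prod.mono_neutral_cong_right) (auto simp: B_def measure_pmf_single)
  finally show ?thesis by simp
qed

lemma random_grid_subset: "A \<in> set_pmf (random_grid d n q) \<Longrightarrow> A \<subseteq> grid d n"
  by (auto simp: random_grid_def)

lemma finite_sidon_subsets: "finite A \<Longrightarrow> finite {S. S \<subseteq> A \<and> sidon S}"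
  by (rule finite_subset[of _ "Pow A"]) auto

lemma card_le_max_sidon:
  assumes "finite A" "S \<subseteq> A" "sidon S"
  shows "card S \<le> max_sidon A"
  unfolding max_sidon_def using assms finite_sidon_subsets by (intro Max_ge) auto

lemma sidon_subset_of_card:
  assumes "finite A" "k \<le> max_sidon A"
  obtains S where "S \<subseteq> A" "sidon S" "card S = k"
proof -
  have "max_sidon A \<in> card ` {S. S \<subseteq> A \<and> sidon S}"
    unfolding max_sidon_def
  proof (rule Max_in)
    show "finite (card ` {S. S \<subseteq> A \<and> sidon S})" using assms finite_sidon_subsets by blast
    have "sidon {}" by (simp add: sidon_def)
    then show "card ` {S. S \<subseteq> A \<and> sidon S} \<noteq> {}" by blast
  qed
  then obtain S where S: "S \<subseteq> A" "sidon S" "card S = max_sidon A" by auto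
  then obtain T where "T \<subseteq> S" "card T = k"
    using obtain_subset_with_card_n assms(2) by metis
  with S show ?thesis using that sidon_subset by blast
qed

section \<open>The upper bound\<close>

text \<open>
  The union bound over all Sidon sets of size \<open>k\<close>: a larger Sidon set contains one of size exactly
  \<open>k\<close>.
\<close>
lemma prob_max_sidon_ge_le:
  assumes "0 \<le> q" "q \<le> 1"
  shows "measure_pmf.prob (random_grid d n q) {A. k \<le> max_sidon A} \<le>
           real (card (sidon_sets d n k)) * q ^ k"
proof -
  let ?P = "measure_pmf.prob (random_grid d n q)"
  have "?P {A. k \<le> max_sidon A} \<le> ?P (\<Union>S\<in>sidon_sets d n k. {A. S \<subseteq> A})"
  proof (rule measure_pmf.finite_measure_mono_AE)
    show "AE A in random_grid d n q. A \<in> {A. k \<le> max_sidon A} \<longrightarrow> A \<in> (\<Union>S\<in>sidon_sets d n k. {A. S \<subseteq> A})"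
    proof (rule AE_pmfI, rule impI)
      fix A assume A: "A \<in> set_pmf (random_grid d n q)" "A \<in> {A. k \<le> max_sidon A}"
      have sub: "A \<subseteq> grid d n" using A(1) by (rule random_grid_subset)
      then have "finite A" by (rule finite_subset) simp
      then obtain S where "S \<subseteq> A" "sidon S" "card S = k"
        using A(2) sidon_subset_of_card by blast
      then show "A \<in> (\<Union>S\<in>sidon_sets d n k. {A. S \<subseteq> A})"
        using sub unfolding sidon_sets_def by blast
    qed
  qed auto
  also have "\<dots> \<le> (\<Sum>S\<in>sidon_sets d n k. ?P {A. S \<subseteq> A})"
    by (rule measure_pmf.finite_measure_subadditive_finite) auto
  also have "\<dots> = (\<Sum>S\<in>sidon_sets d n k. q ^ k)"
    using assms by (intro sum.cong refl) (subst prob_random_grid_superset, auto simp: sidon_sets_def)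
  finally show ?thesis by simp
qed

lemma power_bracket:
  fixes b r :: real
  assumes "b > 1" "r \<ge> 1"
  obtains m where "b ^ m \<le> r" "r < b ^ Suc m"
proof -
  have ex: "\<exists>k. r < b ^ k" using assms(1) by (rule real_arch_pow)
  define k where "k = (LEAST k. r < b ^ k)"
  have k: "r < b ^ k" unfolding k_def by (rule LeastI_ex[OF ex])
  then have "k \<noteq> 0" using assms(2) by (cases k) auto
  then obtain m where m: "k = Suc m" by (cases k) auto
  have "\<not> r < b ^ m" using m unfolding k_def by (metis lessI not_less_Least)
  then show ?thesis using that[of m] k m by simp
qed

text \<open>
  The size \<open>M\<close> in the union bound is the largest power of two up to \<open>c X\<close>, so that
  \<open>2\<^sup>d\<^sup>+\<^sup>8 N p / M\<^sup>2 \<le> 2\<^sup>d\<^sup>+\<^sup>1\<^sup>0 / c\<^sup>2\<close> is small. The doubling starts at some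
  \<open>2\<^sup>j\<close> between \<open>2 y\<^sup>1\<^sup>/\<^sup>3\<close> and \<open>4 y\<^sup>1\<^sup>/\<^sup>3\<close>, where \<open>y = 2\<^sup>d\<^sup>+\<^sup>1 N ln N\<close>; this keeps \<open>2\<^sup>j ln N\<close> of order
  \<open>t\<close>. Since \<open>t \<le> X\<close>, the choice of \<open>c\<close> gives \<open>2\<^sup>j ln N \<le> M\<close>, and the factor \<open>N\<close> to the power
  \<open>2 \<cdot> 2\<^sup>j\<close> is at most \<open>e\<^sup>2\<^sup>M\<close>. After squaring, \<open>t \<le> X\<close> becomes the bound
  \<open>n\<^sup>-\<^sup>d\<^sup>/\<^sup>3 (ln n)\<^sup>8\<^sup>/\<^sup>3 \<le> p\<close>.
\<close>
lemma prob_max_sidon_greater_le: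
  fixes d n :: nat and p :: real
  defines "c \<equiv> 2 ^ (d + 8) * (real d)\<^sup>2" and "X \<equiv> sqrt (real (n ^ d) * p)"
    and "t \<equiv> real n powr (real d / 3) * ln (real n) powr (4 / 3)"
  assumes d: "d \<ge> 1" and ln_n: "1 \<le> ln (real n)" and ln_c: "c\<^sup>2 \<le> ln (real n)"
    and p: "0 \<le> p" "p \<le> 1" and X: "t \<le> X"
  shows "measure_pmf.prob (random_grid d n p) {A. c * X < real (max_sidon A)} \<le> 1 / t"
proof -
  define N where "N = real (n ^ d)"
  have n: "n > 0" using ln_n by (intro Nat.gr0I) auto
  have N: "N \<ge> 1" using n by (simp add: N_def)
  have lnN: "ln N = real d * ln (real n)" using n by (simp add: N_def ln_realpow)
  have lnN_ge: "ln (real n) \<le> ln N" using d ln_n by (simp add: lnN)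
  have t1: "1 \<le> t"
  proof -
    have "1 * 1 \<le> real n powr (real d / 3) * ln (real n) powr (4 / 3)"
      using n ln_n by (intro mult_mono ge_one_powr_ge_zero) auto
    then show ?thesis by (simp add: t_def)
  qed
  have t3: "t ^ 3 = N * ln (real n) ^ 4"
  proof -
    have "t ^ 3 = (real n powr (real d / 3)) ^ 3 * (ln (real n) powr (4 / 3)) ^ 3"
      by (simp add: t_def power_mult_distrib)
    also have "(real n powr (real d / 3)) ^ 3 = real n powr real d"
      using n by (simp add: powr_powr flip: powr_numeral)
    also have "\<dots> = N" using n by (simp add: powr_realpow N_def)
    also have "(ln (real n) powr (4 / 3)) ^ 3 = ln (real n) powr 4"
      using ln_n by (simp add: powr_powr flip: powr_numeral)
    also have "\<dots> = ln (real n) ^ 4" using ln_n by simp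
    finally show ?thesis .
  qed
  have c: "c \<ge> 2 ^ 9"
  proof -
    have "(2::real) ^ 9 * 1 \<le> 2 ^ (d + 8) * (real d)\<^sup>2"
      using d by (intro mult_mono power_increasing one_le_power) auto
    then show ?thesis by (simp add: c_def)
  qed
  have "1 * 1 \<le> c * X" using c X t1 by (intro mult_mono) auto
  then obtain m where m: "2 ^ m \<le> c * X" "c * X < 2 ^ Suc m"
    using power_bracket[of 2 "c * X"] by auto
  define M where "M = (2::nat) ^ m"
  have M: "real M \<le> c * X" "c / 2 * X \<le> real M" using m by (auto simp: M_def)
  have M2: "(real M)\<^sup>2 = 4 ^ m"
    by (simp add: M_def power2_eq_square flip: power_mult_distrib)
  have X2: "X\<^sup>2 = N * p" using p N by (simp add: X_def N_def)
  define y where "y = 2 ^ (d + 1) * N * ln N"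
  have "1 * 1 * 1 \<le> y"
    unfolding y_def using N lnN_ge ln_n by (intro mult_mono one_le_power) auto
  then obtain i where i: "8 ^ i \<le> 8 * y" "8 * y < 8 ^ Suc i"
    using power_bracket[of 8 "8 * y"] by auto
  define j where "j = Suc i"
  have j: "8 * y \<le> 8 ^ j" "8 ^ j \<le> 64 * y" using i by (auto simp: j_def)
  \<comment> \<open>Both sides are compared after cubing, where the fractional exponents disappear.\<close>
  have jM: "2 ^ j * ln N \<le> real M"
  proof (rule power_le_imp_le_base)
    have "(2 ^ j * ln N) ^ Suc 2 = 8 ^ j * ln N ^ 3"
      by (simp add: power_mult_distrib power3_eq_cube flip: power_mult_distrib)
    also have "\<dots> \<le> 64 * y * ln N ^ 3"
      using j lnN_ge ln_n by (intro mult_right_mono) auto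
    also have "\<dots> = 2 ^ (d + 7) * real d ^ 4 * t ^ 3"
      unfolding y_def t3 lnN by (simp add: power_add power_mult_distrib power3_eq_cube power4_eq_xxxx)
    also have "\<dots> \<le> (c / 2) ^ 3 * t ^ 3"
    proof (intro mult_right_mono)
      have "(2::real) ^ (d + 7) * real d ^ 4 \<le> 2 ^ (3 * (d + 7)) * real d ^ 6"
        using d by (intro mult_mono power_increasing) auto
      also have "\<dots> = (c / 2) ^ 3"
        by (simp add: c_def power_mult_distrib power_add power_mult flip: power_mult)
      finally show "2 ^ (d + 7) * real d ^ 4 \<le> (c / 2) ^ 3" .
    qed (use t1 in auto)
    also have "\<dots> = (c / 2 * t) ^ 3" by (simp only: power_mult_distrib)
    also have "\<dots> \<le> real M ^ 3"
    proof (rule power_mono)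
      have "c / 2 * t \<le> c / 2 * X" using X c by (intro mult_left_mono) auto
      then show "c / 2 * t \<le> real M" using M(2) by linarith
      show "0 \<le> c / 2 * t" using c t1 by simp
    qed
    finally show "(2 ^ j * ln N) ^ Suc 2 \<le> real M ^ Suc 2" by (simp add: numeral_3_eq_3)
  qed auto
  have "(2::real) ^ j \<le> 2 ^ m"
  proof -
    have "(2::real) ^ j * 1 \<le> 2 ^ j * ln N" using lnN_ge ln_n by (intro mult_left_mono) auto
    then show ?thesis
      using jM unfolding M_def of_nat_power of_nat_numeral mult_1_right by (rule order_trans)
  qed
  then have "j \<le> m" by (simp add: power_increasing_iff)
  have small: "4 ^ k \<le> y" if "k < m" for k
  proof -
    have "(4::real) ^ k \<le> 4 ^ m" using that by (intro power_increasing) auto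
    also have "\<dots> \<le> (c * X)\<^sup>2" unfolding M2 [symmetric] using M(1) by (intro power_mono) auto
    also have "\<dots> = c\<^sup>2 * (N * p)" by (simp add: power_mult_distrib X2)
    also have "\<dots> \<le> ln N * (N * 1)"
      using ln_c lnN_ge p N by (intro mult_mono) auto
    also have "\<dots> \<le> 2 ^ (d + 1) * (N * ln N)"
    proof -
      have "1 * (N * ln N) \<le> 2 ^ (d + 1) * (N * ln N)"
        using N lnN_ge ln_n by (intro mult_right_mono one_le_power) auto
      then show ?thesis by (simp only: mult_1_left mult_1_right mult.commute)
    qed
    finally show ?thesis by (simp add: y_def mult.assoc)
  qed
  have base: "2 ^ (d + 8) * N / 4 ^ m * p \<le> 1 / 64"
  proof -
    have "64 * (2 ^ (d + 8) * (N * p)) \<le> (c / 2)\<^sup>2 * (N * p)"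
    proof -
      have "(2::real) ^ (d + 14) * 1 \<le> 2 ^ (2 * (d + 7)) * real d ^ 4"
        using d by (intro mult_mono power_increasing one_le_power) auto
      also have "\<dots> = (c / 2)\<^sup>2"
        by (simp add: c_def power_mult_distrib power_add power_mult flip: power_mult)
      finally have "2 ^ (d + 14) * (N * p) \<le> (c / 2)\<^sup>2 * (N * p)"
        using N p by (intro mult_right_mono) auto
      then show ?thesis by (simp add: power_add)
    qed
    also have "\<dots> = (c / 2 * X)\<^sup>2" by (simp only: power_mult_distrib X2)
    also have "\<dots> \<le> 4 ^ m"
      unfolding M2 [symmetric] using M(2) c X t1 by (intro power_mono) auto
    finally show ?thesis by (simp add: field_simps)
  qed
  have "measure_pmf.prob (random_grid d n p) {A. c * X < real (max_sidon A)} \<le>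
      measure_pmf.prob (random_grid d n p) {A. M \<le> max_sidon A}"
    using M(1) by (intro measure_pmf.finite_measure_mono) auto
  also have "\<dots> \<le> real (card (sidon_sets d n M)) * p ^ M"
    using p by (rule prob_max_sidon_ge_le)
  also have "\<dots> \<le> (N powr (2 * 2 ^ j - 8 ^ j / 4 ^ m) * (2 ^ (d + 8) * N / 4 ^ m) ^ M) * p ^ M"
    using card_sidon_sets_le[OF n, of d j m] j(1) \<open>j \<le> m\<close> small p
    unfolding M_def N_def y_def by (intro mult_right_mono) auto
  also have "\<dots> = N powr (2 * 2 ^ j - 8 ^ j / 4 ^ m) * (2 ^ (d + 8) * N / 4 ^ m * p) ^ M"
    by (simp only: power_mult_distrib mult.assoc)
  also have "\<dots> \<le> 9 ^ M * (1 / 64) ^ M"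
  proof (intro mult_mono)
    have "N powr (2 * 2 ^ j - 8 ^ j / 4 ^ m) \<le> N powr (2 * 2 ^ j)"
      using N by (intro powr_mono) auto
    also have "\<dots> = exp (2 * (2 ^ j * ln N))" using N by (simp add: powr_def mult_ac)
    also have "\<dots> \<le> exp (2 * real M)" using jM by simp
    also have "\<dots> = (exp 1 ^ 2) ^ M"
      by (simp add: mult.commute flip: exp_of_nat_mult)
    also have "\<dots> \<le> 9 ^ M"
    proof (rule power_mono)
      have "exp (1::real) ^ 2 \<le> 3 ^ 2" using exp_le by (intro power_mono) auto
      then show "exp (1::real) ^ 2 \<le> 9" by simp
    qed simp
    finally show "N powr (2 * 2 ^ j - 8 ^ j / 4 ^ m) \<le> 9 ^ M" .
    show "(2 ^ (d + 8) * N / 4 ^ m * p) ^ M \<le> (1 / 64) ^ M"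
      using base p N by (intro power_mono) auto
  qed (use N p in auto)
  also have "\<dots> = (9 / 64) ^ M" by (simp flip: power_mult_distrib)
  also have "\<dots> \<le> (1 / 2) ^ M" by (intro power_mono) auto
  also have "\<dots> \<le> 1 / real M"
  proof -
    have "M < 2 ^ M" by (rule less_exp)
    then have "real M \<le> 2 ^ M" by (metis less_imp_le of_nat_le_iff of_nat_numeral of_nat_power)
    then show ?thesis by (simp add: M_def field_simps)
  qed
  also have "\<dots> \<le> 1 / t"
  proof (rule divide_left_mono)
    have "1 * t \<le> c / 2 * X" using c X t1 by (intro mult_mono) auto
    then show "t \<le> real M" using M(2) by linarith
  qed (use t1 in \<open>auto simp: M_def\<close>)
  finally show ?thesis .
qed

section \<open>The lower bound\<close>

definition digit_vector :: "nat \<Rightarrow> nat \<Rightarrow> nat \<Rightarrow> nat \<Rightarrow> int" where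
  "digit_vector d n k i = (if i < d then int (k div n ^ i mod n) else 0)"

definition digit_value :: "nat \<Rightarrow> nat \<Rightarrow> (nat \<Rightarrow> int) \<Rightarrow> int" where
  "digit_value d n a = (\<Sum>i<d. a i * int n ^ i)"

lemma digit_value_add: "digit_value d n (\<lambda>i. a i + b i) = digit_value d n a + digit_value d n b"
  by (simp add: digit_value_def distrib_right sum.distrib)

lemma digit_vector_in_grid: "n > 0 \<Longrightarrow> digit_vector d n k \<in> grid d n"
proof -
  assume "n > 0"
  then have "int (k div n ^ i mod n) \<le> int n - 1" for i
    using mod_less_divisor[of n "k div n ^ i"] by linarith
  then show ?thesis by (simp add: digit_vector_def grid_def PiE_dflt_def)
qed

lemma digit_value_digit_vector:
  assumes "k < n ^ d"
  shows "digit_value d n (digit_vector d n k) = int k"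
proof -
  have "(\<Sum>i<d. k div n ^ i mod n * n ^ i) = k mod n ^ d" for k
  proof (induction d)
    case (Suc d)
    have "k mod (n ^ d * n) = n ^ d * (k div n ^ d mod n) + k mod n ^ d"
      by (rule mod_mult2_eq)
    with Suc show ?case by (simp add: mult_ac)
  qed auto
  then have "int (\<Sum>i<d. k div n ^ i mod n * n ^ i) = int k"
    using assms by simp
  then show ?thesis by (simp add: digit_value_def digit_vector_def)
qed

text \<open>
  The leading term is a multiple of \<open>2q\<close>, and the squares modulo \<open>q\<close> of two elements add up to less
  than \<open>2q\<close>. So a sum of two values reveals both \<open>x + y\<close> and \<open>x\<^sup>2 + y\<^sup>2\<close> modulo \<open>q\<close>.
\<close>
definition erdos_turan :: "nat \<Rightarrow> nat \<Rightarrow> nat" where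
  "erdos_turan q x = 2 * q * x + x\<^sup>2 mod q"

lemma erdos_turan_less: "x < q \<Longrightarrow> erdos_turan q x < 2 * q\<^sup>2"
proof -
  assume x: "x < q"
  then have "x\<^sup>2 mod q < q" by simp
  moreover have "2 * q * x + 2 * q \<le> 2 * q\<^sup>2"
    using x mult_le_mono2[of "x + 1" q "2 * q"] by (simp add: power2_eq_square)
  ultimately show ?thesis unfolding erdos_turan_def using x by linarith
qed

text \<open>
  If \<open>x + y = u + v\<close>, then \<open>x\<^sup>2 + y\<^sup>2 - u\<^sup>2 - v\<^sup>2 = 2 (x - u) (x - v)\<close>. For an odd prime \<open>q\<close> dividing this,
  one of the last two factors is divisible by \<open>q\<close>, hence 0.
\<close>
lemma erdos_turan_sidon:
  assumes q: "prime q" "q > 2" and less: "x < q" "y < q" "u < q" "v < q"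
    and eq: "erdos_turan q x + erdos_turan q y = erdos_turan q u + erdos_turan q v"
  shows "{x, y} = {u, v}"
proof -
  have small: "a\<^sup>2 mod q + b\<^sup>2 mod q < 2 * q" for a b
    using q mod_less_divisor[of q "a\<^sup>2"] mod_less_divisor[of q "b\<^sup>2"] by linarith
  have eq': "2 * q * (x + y) + (x\<^sup>2 mod q + y\<^sup>2 mod q) = 2 * q * (u + v) + (u\<^sup>2 mod q + v\<^sup>2 mod q)"
    using eq by (simp add: erdos_turan_def algebra_simps)
  have "x + y = (2 * q * (x + y) + (x\<^sup>2 mod q + y\<^sup>2 mod q)) div (2 * q)"
    using small[of x y] q by simp
  also have "\<dots> = u + v"
    unfolding eq' using small[of u v] q by simp
  finally have sum: "x + y = u + v" .
  with eq' have "x\<^sup>2 mod q + y\<^sup>2 mod q = u\<^sup>2 mod q + v\<^sup>2 mod q" by simp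
  then have "(x\<^sup>2 mod q + y\<^sup>2 mod q) mod q = (u\<^sup>2 mod q + v\<^sup>2 mod q) mod q"
    by (rule arg_cong)
  then have "(x\<^sup>2 + y\<^sup>2) mod q = (u\<^sup>2 + v\<^sup>2) mod q"
    unfolding mod_add_eq .
  then have sq: "int ((x\<^sup>2 + y\<^sup>2) mod q) = int ((u\<^sup>2 + v\<^sup>2) mod q)" by (rule arg_cong)
  define X Y U V where "X = int x" "Y = int y" "U = int u" "V = int v"
  have SUM: "Y = U + V - X" using sum by (simp add: X_Y_U_V_def)
  have "(X\<^sup>2 + Y\<^sup>2) mod int q = (U\<^sup>2 + V\<^sup>2) mod int q"
    using sq unfolding X_Y_U_V_def by (simp only: of_nat_add of_nat_mod of_nat_power)
  then have "int q dvd (X\<^sup>2 + Y\<^sup>2) - (U\<^sup>2 + V\<^sup>2)"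
    by (simp add: mod_eq_dvd_iff)
  also have "(X\<^sup>2 + Y\<^sup>2) - (U\<^sup>2 + V\<^sup>2) = 2 * ((X - U) * (X - V))"
    unfolding SUM by (simp add: power2_eq_square algebra_simps)
  finally have dvd: "int q dvd 2 * ((X - U) * (X - V))" .
  have pq: "prime (int q)" using q by simp
  have "\<not> int q dvd 2"
    using q by (auto dest: zdvd_imp_le)
  with dvd pq have "int q dvd X - U \<or> int q dvd X - V"
    by (simp add: prime_dvd_mult_iff)
  then have "X = U \<or> X = V"
  proof
    assume "int q dvd X - U"
    moreover have "\<bar>X - U\<bar> < int q" using less by (auto simp: X_Y_U_V_def)
    ultimately show ?thesis using dvd_imp_le_int[of "X - U" "int q"] by force
  next
    assume "int q dvd X - V"
    moreover have "\<bar>X - V\<bar> < int q" using less by (auto simp: X_Y_U_V_def)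
    ultimately show ?thesis using dvd_imp_le_int[of "X - V" "int q"] by force
  qed
  then show ?thesis using sum by (auto simp: X_Y_U_V_def)
qed

text \<open>
  Grid points whose digit value is \<open>r\<close> modulo \<open>L\<close>. Only \<open>n\<^sup>d div L\<close> of them are taken, although some
  residues have one more, so that all classes have the same size.
\<close>
definition residue_class :: "nat \<Rightarrow> nat \<Rightarrow> nat \<Rightarrow> nat \<Rightarrow> (nat \<Rightarrow> int) set" where
  "residue_class d n L r = (\<lambda>j. digit_vector d n (r + L * j)) ` {..<n ^ d div L}"

lemma residue_class:
  assumes "n > 0" "r < L"
  shows "residue_class d n L r \<subseteq> grid d n"
    and "card (residue_class d n L r) = n ^ d div L"
    and "a \<in> residue_class d n L r \<Longrightarrow> digit_value d n a mod int L = int r"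
proof -
  have val: "digit_value d n (digit_vector d n (r + L * j)) = int (r + L * j)" if "j < n ^ d div L" for j
  proof (rule digit_value_digit_vector)
    have "r + L * j < L * Suc j" using assms by simp
    also have "\<dots> \<le> L * (n ^ d div L)" using that by (intro mult_le_mono2) simp
    also have "\<dots> \<le> n ^ d" by simp
    finally show "r + L * j < n ^ d" .
  qed
  show "residue_class d n L r \<subseteq> grid d n"
    using digit_vector_in_grid[OF assms(1)] by (auto simp: residue_class_def)
  have "inj_on (\<lambda>j. digit_vector d n (r + L * j)) {..<n ^ d div L}"
  proof (rule inj_onI)
    fix i j assume "i \<in> {..<n ^ d div L}" "j \<in> {..<n ^ d div L}"
      "digit_vector d n (r + L * i) = digit_vector d n (r + L * j)"
    then have "int (r + L * i) = int (r + L * j)" using val by (metis lessThan_iff)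
    then show "i = j" using assms by simp
  qed
  then show "card (residue_class d n L r) = n ^ d div L"
    by (simp add: residue_class_def card_image)
  assume "a \<in> residue_class d n L r"
  then obtain j where j: "j < n ^ d div L" "a = digit_vector d n (r + L * j)"
    by (auto simp: residue_class_def)
  then have "digit_value d n a mod int L = int ((r + L * j) mod L)"
    using val by (simp only: of_nat_mod)
  then show "digit_value d n a mod int L = int r" using assms by simp
qed

text \<open>
  One representative from each class that meets \<open>A\<close> gives a Sidon set: the digit value modulo \<open>4 q\<^sup>2\<close>
  is additive and sends the representatives injectively to the values of \<open>erdos_turan q\<close>. These
  values are below \<open>2 q\<^sup>2\<close>, so sums of two of them are unaffected by the reduction.
\<close>
lemma card_hit_classes_le_max_sidon:
  fixes d n q :: nat and A :: "(nat \<Rightarrow> int) set"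
  defines "C \<equiv> \<lambda>x. residue_class d n (4 * q\<^sup>2) (erdos_turan q x)"
  assumes q: "prime q" "q > 2" and n: "n > 0" and A: "finite A"
  shows "card {x \<in> {..<q}. A \<inter> C x \<noteq> {}} \<le> max_sidon A"
proof -
  define H where "H = {x \<in> {..<q}. A \<inter> C x \<noteq> {}}"
  have "\<forall>x\<in>H. \<exists>a. a \<in> A \<inter> C x" by (auto simp: H_def)
  then obtain \<rho> where rep: "\<forall>x\<in>H. \<rho> x \<in> A \<inter> C x" by (rule bchoice [THEN exE])
  have \<rho>: "\<rho> x \<in> A" "digit_value d n (\<rho> x) mod int (4 * q\<^sup>2) = int (erdos_turan q x)" if "x \<in> H" for x
  proof -
    have a: "\<rho> x \<in> A \<inter> C x" using rep that by (rule bspec)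
    have b: "erdos_turan q x < 4 * q\<^sup>2"
      using that erdos_turan_less[of x q] by (simp add: H_def)
    show "\<rho> x \<in> A" using a by blast
    show "digit_value d n (\<rho> x) mod int (4 * q\<^sup>2) = int (erdos_turan q x)"
      using a by (intro residue_class(3)[OF n b]) (simp add: C_def)
  qed
  have key: "{x, y} = {u, v}" if m: "x \<in> H" "y \<in> H" "u \<in> H" "v \<in> H"
    and eq: "(\<lambda>i. \<rho> x i + \<rho> y i) = (\<lambda>i. \<rho> u i + \<rho> v i)" for x y u v
  proof (rule erdos_turan_sidon[OF q])
    show less: "x < q" "y < q" "u < q" "v < q" using m by (auto simp: H_def)
    have mod: "digit_value d n (\<lambda>i. \<rho> x i + \<rho> y i) mod int (4 * q\<^sup>2) =
        int (erdos_turan q x + erdos_turan q y)" if "x \<in> H" "y \<in> H" for x y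
    proof -
      have "digit_value d n (\<lambda>i. \<rho> x i + \<rho> y i) mod int (4 * q\<^sup>2) =
         (digit_value d n (\<rho> x) mod int (4 * q\<^sup>2) + digit_value d n (\<rho> y) mod int (4 * q\<^sup>2)) mod int (4 * q\<^sup>2)"
        by (simp only: digit_value_add mod_add_eq)
      also have "\<dots> = int ((erdos_turan q x + erdos_turan q y) mod (4 * q\<^sup>2))"
        by (simp only: \<rho>(2) that of_nat_add of_nat_mod)
      also have "(erdos_turan q x + erdos_turan q y) mod (4 * q\<^sup>2) = erdos_turan q x + erdos_turan q y"
        using that erdos_turan_less[of x q] erdos_turan_less[of y q] by (simp add: H_def)
      finally show ?thesis .
    qed
    show "erdos_turan q x + erdos_turan q y = erdos_turan q u + erdos_turan q v"
      using mod[OF m(1,2)] mod[OF m(3,4)] eq by (metis of_nat_eq_iff)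
  qed
  have inj: "inj_on \<rho> H"
  proof (rule inj_onI)
    fix x y assume xy: "x \<in> H" "y \<in> H" "\<rho> x = \<rho> y"
    have "{x, x} = {y, y}" by (rule key) (simp_all add: xy)
    then show "x = y" by auto
  qed
  have "sidon (\<rho> ` H)"
    unfolding sidon_def
  proof (intro ballI impI)
    fix a b c e assume "a \<in> \<rho> ` H" "b \<in> \<rho> ` H" "c \<in> \<rho> ` H" "e \<in> \<rho> ` H"
      and eq: "(\<lambda>i. a i + b i) = (\<lambda>i. c i + e i)"
    then obtain x y u v where m: "x \<in> H" "y \<in> H" "u \<in> H" "v \<in> H"
      and e: "a = \<rho> x" "b = \<rho> y" "c = \<rho> u" "e = \<rho> v" by blast
    have "{x, y} = {u, v}" by (rule key[OF m]) (use eq e in simp)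
    then have "\<rho> ` {x, y} = \<rho> ` {u, v}" by (rule arg_cong)
    then show "{a, b} = {c, e}" by (simp only: e image_insert image_empty)
  qed
  moreover have "\<rho> ` H \<subseteq> A" using \<rho> by blast
  ultimately have "card (\<rho> ` H) \<le> max_sidon A" by (intro card_le_max_sidon A)
  then show ?thesis unfolding card_image[OF inj] unfolding H_def .
qed

text \<open>
  If the largest Sidon set is small, then the random set misses at least half of the classes entirely.
  A union bound over the at most \<open>2\<^sup>q\<close> possible collections \<open>T\<close> of missed classes suffices, because each
  collection is missed with probability at most \<open>e\<^sup>-\<^sup>2\<^sup>q\<close>: the classes in \<open>T\<close> are disjoint and have
  together at least \<open>(q / 2) (N / (2 L)) \<ge> 2 q / p\<close> points.
\<close>
lemma prob_max_sidon_less_half_le: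
  assumes q: "prime q" "q > 2" and n: "n > 0" and p: "0 \<le> p" "p \<le> 1"
    and large: "32 * (real q)\<^sup>2 \<le> p * real (n ^ d)"
  shows "measure_pmf.prob (random_grid d n p) {A. real (max_sidon A) < real q / 2} \<le>
           2 ^ q * exp (- 2 * real q)"
proof -
  let ?P = "measure_pmf.prob (random_grid d n p)"
  define L where "L = 4 * q\<^sup>2"
  define C where "C x = residue_class d n L (erdos_turan q x)" for x
  define \<T> where "\<T> = {T. T \<subseteq> {..<q} \<and> real q / 2 \<le> real (card T)}"
  have L: "L > 0" "real L = 4 * (real q)\<^sup>2" using q by (simp_all add: L_def)
  have eL: "erdos_turan q x < L" if "x < q" for x
    using that erdos_turan_less[of x q] by (simp add: L_def)
  have fin: "finite \<T>" unfolding \<T>_def by (rule finite_subset[of _ "Pow {..<q}"]) auto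
  have "?P {A. real (max_sidon A) < real q / 2} \<le> ?P (\<Union>T\<in>\<T>. {A. A \<inter> (\<Union>x\<in>T. C x) = {}})"
  proof (rule measure_pmf.finite_measure_mono_AE)
    show "AE A in random_grid d n p. A \<in> {A. real (max_sidon A) < real q / 2} \<longrightarrow>
        A \<in> (\<Union>T\<in>\<T>. {A. A \<inter> (\<Union>x\<in>T. C x) = {}})"
    proof (rule AE_pmfI, rule impI)
      fix A assume A: "A \<in> set_pmf (random_grid d n p)" "A \<in> {A. real (max_sidon A) < real q / 2}"
      have "finite A" using random_grid_subset[OF A(1)] by (rule finite_subset) simp
      then have hit: "card {x \<in> {..<q}. A \<inter> C x \<noteq> {}} \<le> max_sidon A"
        unfolding C_def L_def by (rule card_hit_classes_le_max_sidon[OF q n])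
      define T where "T = {x \<in> {..<q}. A \<inter> C x = {}}"
      have "T = {..<q} - {x \<in> {..<q}. A \<inter> C x \<noteq> {}}" by (auto simp: T_def)
      then have "card T = q - card {x \<in> {..<q}. A \<inter> C x \<noteq> {}}"
        by (simp only: card_lessThan) (subst card_Diff_subset, auto)
      then have "T \<in> \<T>" using hit A(2) by (auto simp: \<T>_def T_def)
      moreover have "A \<inter> (\<Union>x\<in>T. C x) = {}" by (auto simp: T_def)
      ultimately show "A \<in> (\<Union>T\<in>\<T>. {A. A \<inter> (\<Union>x\<in>T. C x) = {}})" by blast
    qed
  qed auto
  also have "\<dots> \<le> (\<Sum>T\<in>\<T>. ?P {A. A \<inter> (\<Union>x\<in>T. C x) = {}})"
    using fin by (rule measure_pmf.finite_measure_subadditive_finite) auto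
  also have "\<dots> \<le> (\<Sum>T\<in>\<T>. exp (- 2 * real q))"
  proof (rule sum_mono)
    fix T assume T: "T \<in> \<T>"
    then have Tq: "T \<subseteq> {..<q}" and Tc: "real q / 2 \<le> real (card T)" by (auto simp: \<T>_def)
    have finT: "finite T" using Tq finite_subset by blast
    have sub: "(\<Union>x\<in>T. C x) \<subseteq> grid d n"
      using residue_class(1)[OF n eL] Tq unfolding C_def by blast
    have disj: "C x \<inter> C y = {}" if "x \<in> T" "y \<in> T" "x \<noteq> y" for x y
    proof (rule ccontr)
      assume "C x \<inter> C y \<noteq> {}"
      then obtain a where "a \<in> C x" "a \<in> C y" by blast
      then have "int (erdos_turan q x) = int (erdos_turan q y)"
        using that Tq residue_class(3)[OF n eL] unfolding C_def by (metis lessThan_iff subsetD)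
      then have "{x, x} = {y, y}"
        using that Tq by (intro erdos_turan_sidon[OF q]) auto
      with that show False by auto
    qed
    have "card (\<Union>x\<in>T. C x) = (\<Sum>x\<in>T. card (C x))"
      using finT disj by (intro card_UN_disjoint) (auto simp: C_def residue_class_def)
    also have "\<dots> = (\<Sum>x\<in>T. n ^ d div L)"
      using Tq residue_class(2)[OF n eL] unfolding C_def by (intro sum.cong) auto
    finally have card: "card (\<Union>x\<in>T. C x) = card T * (n ^ d div L)" by simp
    \<comment> \<open>The floor in \<open>n ^ d div L\<close> costs at most a factor 2, as \<open>L \<le> n ^ d\<close>.\<close>
    have LN: "8 * real L \<le> p * real (n ^ d)" using large L by simp
    also have "\<dots> \<le> real (n ^ d)" using p by (simp add: mult_left_le_one_le)
    finally have "L \<le> n ^ d" by linarith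
    then have "1 \<le> n ^ d div L" using L by (simp add: div_greater_zero_iff Suc_le_eq)
    moreover have "real (n ^ d) < real L * (real (n ^ d div L) + 1)"
    proof -
      have "n ^ d < L * (n ^ d div L + 1)"
        using L by (metis add.commute dividend_less_times_div mult_Suc_right plus_1_eq_Suc)
      then have "real (n ^ d) < real (L * (n ^ d div L + 1))" unfolding of_nat_less_iff .
      then show ?thesis by (simp add: distrib_left)
    qed
    ultimately have "real (n ^ d) \<le> real L * (2 * real (n ^ d div L))"
      using L by (smt (verit) mult_left_mono of_nat_0_le_iff of_nat_1 of_nat_le_iff)
    then have "p * real (n ^ d) \<le> p * (real L * (2 * real (n ^ d div L)))"
      using p(1) by (rule mult_left_mono)
    with LN have "8 * real L \<le> real L * (2 * (p * real (n ^ d div L)))" by (simp add: mult_ac)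
    then have p4: "4 \<le> p * real (n ^ d div L)" using L(1) by simp
    have "?P {A. A \<inter> (\<Union>x\<in>T. C x) = {}} = (1 - p) ^ (card T * (n ^ d div L))"
      using prob_random_grid_avoid[OF sub p] by (simp only: card)
    also have "\<dots> \<le> exp (- p) ^ (card T * (n ^ d div L))"
      using p exp_ge_add_one_self[of "- p"] by (intro power_mono) auto
    also have "\<dots> = exp (- (real (card T) * (p * real (n ^ d div L))))"
      by (simp add: mult_ac flip: exp_of_nat_mult)
    also have "\<dots> \<le> exp (- 2 * real q)"
    proof -
      have "(real q / 2) * 4 \<le> real (card T) * (p * real (n ^ d div L))"
        using Tc p4 by (intro mult_mono) auto
      then show ?thesis by simp
    qed
    finally show "?P {A. A \<inter> (\<Union>x\<in>T. C x) = {}} \<le> exp (- 2 * real q)" .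
  qed
  also have "\<dots> = real (card \<T>) * exp (- 2 * real q)" by simp
  also have "\<dots> \<le> 2 ^ q * exp (- 2 * real q)"
  proof (intro mult_right_mono)
    have "card \<T> \<le> card (Pow {..<q})" by (intro card_mono) (auto simp: \<T>_def)
    then show "real (card \<T>) \<le> 2 ^ q" by (simp add: card_Pow flip: of_nat_le_iff)
  qed auto
  finally show ?thesis .
qed

text \<open>
  The prime \<open>q\<close> is taken between the two consecutive powers of 4 for which the larger one is still at
  most \<open>X / \<surd>32\<close>, where \<open>X = \<surd>(n\<^sup>d p)\<close>. This is the largest scale allowed by \<open>32 q\<^sup>2 \<le> X\<^sup>2\<close>, and
  it loses at most a factor 16, whence \<open>q \<ge> X / 100\<close>. The threshold \<open>K\<close> guarantees that the power of 4 is
  beyond the point from which primes are known to exist.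
\<close>
lemma prob_max_sidon_small_le:
  "\<exists>K\<ge>1. \<forall>d n p. n > 0 \<longrightarrow> 0 \<le> p \<longrightarrow> p \<le> 1 \<longrightarrow> K \<le> sqrt (real (n ^ d) * p) \<longrightarrow>
     measure_pmf.prob (random_grid d n p) {A. real (max_sidon A) < 1 / 200 * sqrt (real (n ^ d) * p)}
       \<le> 100 / sqrt (real (n ^ d) * p)"
proof -
  obtain h0 where h0: "\<And>h. h \<ge> h0 \<Longrightarrow> \<exists>q. prime q \<and> (4::nat) ^ h < q \<and> q \<le> 4 ^ Suc h"
    using eventually_prime_between_powers_of_4 unfolding eventually_sequentially by blast
  define K :: real where "K = 24 * 4 ^ (h0 + 2)"
  have sqrt32: "5 \<le> sqrt 32" "sqrt 32 \<le> (6::real)"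
    by (auto intro: real_le_rsqrt real_le_lsqrt)
  have "measure_pmf.prob (random_grid d n p) {A. real (max_sidon A) < 1 / 200 * X} \<le> 100 / X"
    if n: "n > 0" and p: "0 \<le> p" "p \<le> 1" and X: "X = sqrt (real (n ^ d) * p)" and KX: "K \<le> X" for d n p X
  proof -
    define r where "r = X / (4 * sqrt 32)"
    have "4 * sqrt 32 * 4 ^ (h0 + 2) \<le> X"
    proof -
      have "4 * sqrt 32 * 4 ^ (h0 + 2) \<le> 24 * (4::real) ^ (h0 + 2)"
        using sqrt32 by (intro mult_right_mono) auto
      then show ?thesis using KX by (simp only: K_def)
    qed
    then have r: "4 ^ (h0 + 2) \<le> r" by (simp add: r_def field_simps)
    have "1 \<le> r" using r one_le_power[of "4::real" "h0 + 2"] by linarith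
    then obtain h where h: "4 ^ h \<le> r" "r < 4 ^ Suc h"
      using power_bracket[of 4 r] by auto
    have "(4::real) ^ (h0 + 2) < 4 ^ Suc h" using r h by linarith
    then have h_ge: "h0 + 2 < Suc h" by (simp only: power_strict_increasing_iff)
    then obtain q :: nat where q: "prime q" "4 ^ h < q" "q \<le> 4 ^ Suc h"
      using h0[of h] by auto
    have "(4::nat) ^ 1 \<le> 4 ^ h" using h_ge by (intro power_increasing) auto
    then have q2: "q > 2" using q by simp
    have qr: "real q \<le> 4 ^ Suc h" "4 ^ h < real q"
      using q(2,3) by (metis of_nat_le_iff of_nat_numeral of_nat_power,
        metis of_nat_less_iff of_nat_numeral of_nat_power)
    have X2: "X\<^sup>2 = real (n ^ d) * p" using p by (simp add: X)
    have large: "32 * (real q)\<^sup>2 \<le> p * real (n ^ d)"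
    proof -
      have "real q \<le> 4 * r" using qr(1) h(1) by simp
      also have "\<dots> = X / sqrt 32" by (simp add: r_def)
      finally have "(real q)\<^sup>2 \<le> (X / sqrt 32)\<^sup>2" by (intro power_mono) auto
      then show ?thesis by (simp add: power_divide X2 mult.commute)
    qed
    have "X / 100 \<le> real q"
    proof -
      have "X = 4 * sqrt 32 * r" by (simp add: r_def)
      also have "\<dots> \<le> 4 * 6 * r" using sqrt32 \<open>1 \<le> r\<close> by (intro mult_right_mono) auto
      also have "\<dots> \<le> 4 * 6 * (4 * real q)"
      proof -
        have "r \<le> 4 * 4 ^ h" using h(2) by simp
        also have "\<dots> \<le> 4 * real q" using qr(2) by linarith
        finally show ?thesis by simp
      qed
      finally show ?thesis by simp
    qed
    have "K \<ge> 1" unfolding K_def using one_le_power[of "4::real" "h0 + 2"] by linarith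
    have "measure_pmf.prob (random_grid d n p) {A. real (max_sidon A) < 1 / 200 * X} \<le>
        measure_pmf.prob (random_grid d n p) {A. real (max_sidon A) < real q / 2}"
      using \<open>X / 100 \<le> real q\<close> by (intro measure_pmf.finite_measure_mono) auto
    also have "\<dots> \<le> 2 ^ q * exp (- 2 * real q)"
      by (rule prob_max_sidon_less_half_le[OF q(1) q2 n p large])
    also have "\<dots> \<le> exp 1 ^ q * exp (- 2 * real q)"
      using exp_ge_add_one_self[of "1::real"] by (intro mult_right_mono power_mono) auto
    also have "\<dots> = exp (- real q)" by (simp flip: exp_of_nat_mult exp_add)
    also have "\<dots> \<le> 1 / real q"
    proof -
      have "real q \<le> exp (real q)" using exp_ge_add_one_self[of "real q"] by linarith
      then show ?thesis using q2 by (simp add: exp_minus field_simps)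
    qed
    also have "\<dots> \<le> 1 / (X / 100)"
      using \<open>X / 100 \<le> real q\<close> KX \<open>K \<ge> 1\<close> q2 by (intro divide_left_mono) auto
    finally show ?thesis by simp
  qed
  moreover have "K \<ge> 1" unfolding K_def using one_le_power[of "4::real" "h0 + 2"] by linarith
  ultimately show ?thesis by blast
qed

section \<open>The order of magnitude of the largest Sidon set\<close>

theorem theorem2p7:
  shows "\<exists>c5::real. \<exists>c6::nat \<Rightarrow> real. c5 > 0 \<and> (\<forall>d\<ge>1. c6 d > 0) \<and>
    (\<forall>d\<ge>1. \<forall>p::nat \<Rightarrow> real.
      (\<forall>\<^sub>F n in sequentially.
         real n powr (- (real d / 3)) * ln (real n) powr (8 / 3) \<le> p n \<and> p n \<le> 1) \<longrightarrow>
      (\<lambda>n. measure_pmf.prob (random_grid d n (p n))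
         {A. c5 * real n powr (real d / 2) * p n powr (1 / 2) \<le> real (max_sidon A) \<and>
             real (max_sidon A) \<le> c6 d * real n powr (real d / 2) * p n powr (1 / 2)})
        \<longlonglongrightarrow> 1)"
proof -
  define c6 where "c6 d = 2 ^ (d + 8) * (real d)\<^sup>2" for d
  obtain K where K: "K \<ge> 1" "\<And>d n p. n > 0 \<Longrightarrow> 0 \<le> p \<Longrightarrow> p \<le> 1 \<Longrightarrow> K \<le> sqrt (real (n ^ d) * p) \<Longrightarrow>
     measure_pmf.prob (random_grid d n p) {A. real (max_sidon A) < 1 / 200 * sqrt (real (n ^ d) * p)}
       \<le> 100 / sqrt (real (n ^ d) * p)"
    using prob_max_sidon_small_le by blast
  have "(\<lambda>n. measure_pmf.prob (random_grid d n (p n))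
         {A. 1 / 200 * real n powr (real d / 2) * p n powr (1 / 2) \<le> real (max_sidon A) \<and>
             real (max_sidon A) \<le> c6 d * real n powr (real d / 2) * p n powr (1 / 2)})
        \<longlonglongrightarrow> 1" (is "?prob \<longlonglongrightarrow> 1")
    if d: "d \<ge> 1" and p: "\<forall>\<^sub>F n in sequentially.
         real n powr (- (real d / 3)) * ln (real n) powr (8 / 3) \<le> p n \<and> p n \<le> 1" for d p
  proof -
    define t where "t n = real n powr (real d / 3) * ln (real n) powr (4 / 3)" for n
    have dpos: "real d / 3 > 0" using d by simp
    have t_lim: "filterlim t at_top sequentially"
      unfolding t_def using dpos by real_asymp
    have "\<forall>\<^sub>F n in sequentially. K \<le> t n"
      using t_lim by (simp add: filterlim_at_top)
    moreover have "\<forall>\<^sub>F n in sequentially. max 1 ((c6 d)\<^sup>2) \<le> ln (real n)"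
    proof -
      have "filterlim (\<lambda>n. ln (real n)) at_top sequentially" by real_asymp
      then show ?thesis by (simp only: filterlim_at_top)
    qed
    ultimately have bound: "\<forall>\<^sub>F n in sequentially. 1 - 101 / t n \<le> ?prob n"
      using p
    proof eventually_elim
      case (elim n)
      let ?P = "measure_pmf.prob (random_grid d n (p n))"
      have lns: "1 \<le> ln (real n)" "(c6 d)\<^sup>2 \<le> ln (real n)" using elim by auto
      then have n: "n > 0" by (intro Nat.gr0I) auto
      have "0 < real n powr (- (real d / 3)) * ln (real n) powr (8 / 3)"
        using n lns by (intro mult_pos_pos) auto
      then have p0: "0 < p n" "p n \<le> 1" using elim by linarith+
      define X where "X = sqrt (real (n ^ d) * p n)"
      have X_eq: "real n powr (real d / 2) * p n powr (1 / 2) = X"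
      proof -
        have "X = (real n powr real d) powr (1 / 2) * p n powr (1 / 2)"
          using n p0 by (simp add: X_def powr_half_sqrt real_sqrt_mult powr_realpow)
        then show ?thesis using n by (simp add: powr_powr)
      qed
      \<comment> \<open>Here the assumed lower bound on \<open>p\<close> enters.\<close>
      have tX: "t n \<le> X"
        unfolding X_def
      proof (rule real_le_rsqrt)
        have "(t n)\<^sup>2 = real n powr (2 * real d / 3) * ln (real n) powr (8 / 3)"
          using n lns by (simp add: t_def power_mult_distrib powr_powr field_simps flip: powr_numeral)
        also have "2 * real d / 3 = real d + - (real d / 3)" by simp
        also have "real n powr \<dots> * ln (real n) powr (8 / 3) =
            real n powr real d * (real n powr (- (real d / 3)) * ln (real n) powr (8 / 3))"
          by (simp only: powr_add mult.assoc)
        also have "\<dots> \<le> real n powr real d * p n"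
          using elim by (intro mult_left_mono) auto
        also have "\<dots> = real (n ^ d) * p n" using n by (simp add: powr_realpow)
        finally show "(t n)\<^sup>2 \<le> real (n ^ d) * p n" .
      qed
      have t0: "t n > 0" unfolding t_def using n lns by (intro mult_pos_pos) auto
      let ?low = "{A. real (max_sidon A) < 1 / 200 * X}"
      let ?high = "{A. c6 d * X < real (max_sidon A)}"
      have low: "?P ?low \<le> 100 / t n"
      proof -
        have "?P ?low \<le> 100 / X"
          unfolding X_def using K(2)[OF n, of "p n" d] p0 elim tX by (simp add: X_def)
        also have "\<dots> \<le> 100 / t n" using tX t0 by (intro divide_left_mono) auto
        finally show ?thesis .
      qed
      have high: "?P ?high \<le> 1 / t n"
        unfolding X_def t_def c6_def
        using prob_max_sidon_greater_le[OF d, of n "p n"] lns p0 tX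
        by (simp add: X_def t_def c6_def)
      have "?prob n = ?P (- (?low \<union> ?high))"
        by (intro arg_cong2[of _ _ _ _ measure] refl) (auto simp: X_eq mult.assoc not_less)
      also have "\<dots> = 1 - ?P (?low \<union> ?high)"
        using measure_pmf.prob_compl[of "?low \<union> ?high" "random_grid d n (p n)"]
        by (simp add: Compl_eq_Diff_UNIV)
      finally have "?prob n = 1 - ?P (?low \<union> ?high)" .
      moreover have "?P (?low \<union> ?high) \<le> ?P ?low + ?P ?high"
        by (rule measure_Un_le) auto
      ultimately show ?case using low high by simp
    qed
    show ?thesis
    proof (rule tendsto_sandwich[OF bound])
      show "\<forall>\<^sub>F n in sequentially. ?prob n \<le> 1" by (simp add: measure_pmf.prob_le_1)
      have "(\<lambda>n. 101 / t n) \<longlonglongrightarrow> 0"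
        by (rule real_tendsto_divide_at_top[OF tendsto_const t_lim])
      from tendsto_diff[OF tendsto_const this, of 1] show "(\<lambda>n. 1 - 101 / t n) \<longlonglongrightarrow> 1" by simp
    qed simp
  qed
  moreover have "\<forall>d\<ge>1. c6 d > 0" by (simp add: c6_def)
  ultimately show ?thesis
    by (intro exI[of _ "1 / 200"] exI[of _ c6]) simp
qed

end
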